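(* $\mathbf{ResSV}$ is stronger than $\mathbf{ResS}$: $\mathbf{ResSV}$ p-simulates $\mathbf{ResS}$, but $\mathbf{ResS}$ does not p-simulate $\mathbf{ResSV}$.
   Context: A literal is a Boolean variable $x$ or its negation $\overline x$; a clause is a disjunction of literals ($\Box$ is the empty clause). Weights are elements of $\mathbb{R}_{>0}\cup\{\infty\}$ with $\infty+w=\infty-w=\infty$; during $\mathbf{ResSV}$ proofs clauses may also carry finite negative weights. A MaxSAT formula is a finite collection of weighted clauses $(C,w)$, where $(C,u),(C,v)$ may be merged into $(C,u+v)$ and conversely, and clauses of weight $0$ disappear. The cost $\mathcal F(X)$ of a truth assignment $X$ is the sum of weights of clauses falsified by $X$; $\mathrm{MaxSAT}(\mathcal F)=\min_X\mathcal F(X)$. $\mathcal G\subseteq\mathcal F$ means every $(C,w)\in\mathcal G$ has some $(C,w')\in\mathcal F$ with $w\le w'$. A MaxSAT inference rule replaces its antecedents in the current formula by its consequents. A proof in a proof system $\Delta$ is a sequence $\mathcal F_0;\dots;\mathcal F_e$ (length $e$), each obtained from the previous by one rule application; $\mathcal F\vdash_\Delta\mathcal G$ means there is such a proof with $\mathcal F_0=\mathcal F$, $\mathcal G\subseteq\mathcal F_e$ and all clauses of $\mathcal F_e$ having positive weight. A refutation of $\mathcal F$ is a proof $\mathcal F\vdash_\Delta\{(\Box,\mathrm{MaxSAT}(\mathcal F))\}$. Rules: Resolution: from $(x\lor A,v),(\overline x\lor B,w)$ with $v,w$ positive ($A,B$ possibly empty), with $m=\min\{v,w\}$, derive $(A\lor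 B,m),(x\lor A,v-m),(\overline x\lor B,w-m),(x\lor A\lor\overline B,m),(\overline x\lor B\lor\overline A,m)$, where for $D=l_1\lor\dots\lor l_p$ the expression $(E\lor\overline D,u)$ stands for $(E\lor\overline{l_1},u),(E\lor l_1\lor\overline{l_2},u),\dots,(E\lor l_1\lor\dots\lor l_{p-1}\lor\overline{l_p},u)$ (nothing if $D$ is empty), and tautologies are discarded. Split: from $(A,w)$ with $w$ positive derive $(A\lor x,w),(A\lor\overline x,w)$. Virtual: with no antecedents, introduce $(A,w),(A,-w)$ for any clause $A$ and finite $w$. $\mathbf{ResS}=\{\text{resolution},\text{split}\}$, $\mathbf{ResSV}=\{\text{resolution},\text{split},\text{virtual}\}$. A proof system $\Delta$ p-simulates $\Gamma$ if there is a polynomial-time computable function transforming every $\Gamma$-refutation of a formula into a $\Delta$-refutation of the same formula; $\Delta$ is stronger than $\Gamma$ if $\Delta$ p-simulates $\Gamma$ and $\Gamma$ does not p-simulate $\Delta$. *)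

theory Defs
  imports "HOL-Library.Extended_Real" "HOL-Library.FSet" "HOL-Library.Multiset"
    "HOL-Computational_Algebra.Polynomial"
begin

section \<open>Weighted formulas\<close>

datatype literal = Pos nat | Neg nat

fun negate :: "literal \<Rightarrow> literal" where
  "negate (Pos x) = Neg x"
| "negate (Neg x) = Pos x"

type_synonym clause = "literal fset"

text \<open>
  Isabelle's extended reals satisfy \<open>\<infinity> + w = \<infinity> - w = \<infinity>\<close> for every \<open>w\<close>,
  including \<open>\<infinity> - \<infinity> = \<infinity>\<close>. The value \<open>-\<infinity>\<close> never occurs as a weight.
  Formulas are multisets, not maps from clauses to total weights: otherwise a
  pair \<open>(A, w), (A, -w)\<close> would cancel as soon as it is introduced.
\<close>

type_synonym formula = "(clause \<times> ereal) multiset"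

definition maxsat_formula :: "formula \<Rightarrow> bool" where
  "maxsat_formula F \<longleftrightarrow> (\<forall>(C, w) \<in># F. 0 < w)"

fun lit_true :: "(nat \<Rightarrow> bool) \<Rightarrow> literal \<Rightarrow> bool" where
  "lit_true X (Pos x) \<longleftrightarrow> X x"
| "lit_true X (Neg x) \<longleftrightarrow> \<not> X x"

definition falsifies :: "(nat \<Rightarrow> bool) \<Rightarrow> clause \<Rightarrow> bool" where
  "falsifies X C \<longleftrightarrow> (\<forall>l. l |\<in>| C \<longrightarrow> \<not> lit_true X l)"

definition cost :: "formula \<Rightarrow> (nat \<Rightarrow> bool) \<Rightarrow> ereal" where
  "cost F X = (\<Sum>(C, w) \<in># F. if falsifies X C then w else 0)"

definition MaxSAT :: "formula \<Rightarrow> ereal" where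
  "MaxSAT F = Min (range (cost F))"

lemma finite_range_cost: "finite (range (cost F))"
proof (induction F)
  case empty
  have "range (cost {#}) \<subseteq> {0}" by (auto simp: cost_def)
  then show ?case by (rule finite_subset) simp
next
  case (add Cw F)
  obtain C w where Cw: "Cw = (C, w)" by force
  have "range (cost (add_mset Cw F)) \<subseteq> (\<lambda>c. w + c) ` range (cost F) \<union> range (cost F)"
    by (auto simp: cost_def Cw)
  with add show ?case by (meson finite_UnI finite_imageI finite_subset)
qed

text \<open>\<open>weighted C w\<close> is the formula \<open>{(C, w)}\<close>, in which a clause of weight 0 disappears.\<close>

definition weighted :: "clause \<Rightarrow> ereal \<Rightarrow> formula" where
  "weighted C w = (if w = 0 then {#} else {#(C, w)#})"

definition contained :: "formula \<Rightarrow> formula \<Rightarrow> bool" where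
  "contained G F \<longleftrightarrow> (\<forall>(C, w) \<in># G. \<exists>w'. (C, w') \<in># F \<and> w \<le> w')"

text \<open>
  A clause may only be divided into parts of the same sign. Dividing it into
  parts of opposite sign would amount to an application of the virtual rule,
  and would bring negative weights into proofs that do not use that rule.
\<close>

inductive regroup1 :: "formula \<Rightarrow> formula \<Rightarrow> bool" where
  merge: "regroup1 (H + {#(C, u), (C, v)#}) (H + weighted C (u + v))"
| divide: "0 < u \<and> 0 < v \<or> u < 0 \<and> v < 0 \<Longrightarrow>
    regroup1 (H + {#(C, u + v)#}) (H + {#(C, u), (C, v)#})"

abbreviation regroup :: "formula \<Rightarrow> formula \<Rightarrow> bool" where
  "regroup \<equiv> regroup1\<^sup>*\<^sup>*"

section \<open>Inference rules and proofs\<close>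

text \<open>A rule relates antecedents to consequents.\<close>

type_synonym rule = "formula \<Rightarrow> formula \<Rightarrow> bool"

abbreviation clause_of :: "literal list \<Rightarrow> clause" where
  "clause_of \<equiv> fset_of_list"

definition tautology :: "clause \<Rightarrow> bool" where
  "tautology C \<longleftrightarrow> (\<exists>x. Pos x |\<in>| C \<and> Neg x |\<in>| C)"

definition discard_tautologies :: "formula \<Rightarrow> formula" where
  "discard_tautologies F = filter_mset (\<lambda>(C, w). \<not> tautology C) F"

text \<open>\<open>or_not E [l\<^sub>1, \<dots>, l\<^sub>p] u\<close> is the collection denoted by \<open>(E \<or> \<not> (l\<^sub>1 \<or> \<dots> \<or> l\<^sub>p), u)\<close>.\<close>

fun or_not :: "literal list \<Rightarrow> literal list \<Rightarrow> ereal \<Rightarrow> formula" where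
  "or_not E [] u = {#}"
| "or_not E (l # D) u = weighted (clause_of (E @ [negate l])) u + or_not (E @ [l]) D u"

inductive resolution :: rule where
  "\<lbrakk>0 < v; 0 < w; m = min v w;
    distinct A; Pos x \<notin> set A; distinct B; Neg x \<notin> set B\<rbrakk> \<Longrightarrow>
   resolution
     {#(clause_of (Pos x # A), v), (clause_of (Neg x # B), w)#}
     (discard_tautologies
       (weighted (clause_of (A @ B)) m
        + weighted (clause_of (Pos x # A)) (v - m)
        + weighted (clause_of (Neg x # B)) (w - m)
        + or_not (Pos x # A) B m
        + or_not (Neg x # B) A m))"

inductive split :: rule where
  "0 < w \<Longrightarrow> split {#(A, w)#} {#(finsert (Pos x) A, w), (finsert (Neg x) A, w)#}"

inductive virtual :: rule where
  "\<bar>w\<bar> \<noteq> \<infinity> \<Longrightarrow> virtual {#} (weighted A w + weighted A (- w))"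

type_synonym proof_system = "rule set"

definition ResS :: proof_system where
  "ResS = {resolution, split}"

definition ResSV :: proof_system where
  "ResSV = {resolution, split, virtual}"

definition proof_step :: "proof_system \<Rightarrow> formula \<Rightarrow> formula \<Rightarrow> bool" where
  "proof_step \<Delta> F G \<longleftrightarrow>
     (\<exists>R \<in> \<Delta>. \<exists>P Q H. R P Q \<and> regroup F (P + H) \<and> regroup (Q + H) G)"

definition is_proof :: "proof_system \<Rightarrow> formula list \<Rightarrow> bool" where
  "is_proof \<Delta> Fs \<longleftrightarrow>
     Fs \<noteq> [] \<and> (\<forall>i. Suc i < length Fs \<longrightarrow> proof_step \<Delta> (Fs ! i) (Fs ! Suc i))"

definition proof_of :: "proof_system \<Rightarrow> formula \<Rightarrow> formula \<Rightarrow> formula list \<Rightarrow> bool" where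
  "proof_of \<Delta> F G Fs \<longleftrightarrow>
     is_proof \<Delta> Fs \<and> hd Fs = F \<and>
     (\<exists>F'. regroup (last Fs) F' \<and> contained G F' \<and> (\<forall>(C, w) \<in># F'. 0 < w))"

definition refutation :: "proof_system \<Rightarrow> formula \<Rightarrow> formula list \<Rightarrow> bool" where
  "refutation \<Delta> F Fs \<longleftrightarrow>
     maxsat_formula F \<and> proof_of \<Delta> F (weighted {||} (MaxSAT F)) Fs"

section \<open>Polynomial-time computation\<close>

text \<open>
  Programs control a head on a two-way infinite tape. The instructions that
  touch only symbols make up Turing machines. The remaining ones turn them into
  machines in the sense of Blum, Shub and Smale, which hold a real number in
  a single cell or register and perform exact arithmetic at unit cost.
\<close>

datatype cell = Sym nat | Num real

datatype instr =
    Move_Left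
  | Move_Right
  | Write nat
  | Jump nat
  | Jump_If_Sym nat nat
  | Load nat
  | Store nat
  | Const nat real
  | Add nat nat nat
  | Sub nat nat nat
  | Mul nat nat nat
  | Div nat nat nat
  | Jump_If_Less nat nat nat

type_synonym program = "instr list"

fun symbolic :: "instr \<Rightarrow> bool" where
  "symbolic Move_Left = True"
| "symbolic Move_Right = True"
| "symbolic (Write s) = True"
| "symbolic (Jump j) = True"
| "symbolic (Jump_If_Sym s j) = True"
| "symbolic _ = False"

record config =
  pc :: nat
  head :: int
  tape :: "int \<Rightarrow> cell"
  reg :: "nat \<Rightarrow> real"

fun exec :: "instr \<Rightarrow> config \<Rightarrow> config" where
  "exec Move_Left c = c\<lparr>pc := pc c + 1, head := head c - 1\<rparr>"
| "exec Move_Right c = c\<lparr>pc := pc c + 1, head := head c + 1\<rparr>"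
| "exec (Write s) c = c\<lparr>pc := pc c + 1, tape := (tape c)(head c := Sym s)\<rparr>"
| "exec (Jump j) c = c\<lparr>pc := j\<rparr>"
| "exec (Jump_If_Sym s j) c = c\<lparr>pc := (if tape c (head c) = Sym s then j else pc c + 1)\<rparr>"
| "exec (Load i) c = c\<lparr>pc := pc c + 1,
     reg := (case tape c (head c) of Sym _ \<Rightarrow> reg c | Num r \<Rightarrow> (reg c)(i := r))\<rparr>"
| "exec (Store i) c = c\<lparr>pc := pc c + 1, tape := (tape c)(head c := Num (reg c i))\<rparr>"
| "exec (Const i r) c = c\<lparr>pc := pc c + 1, reg := (reg c)(i := r)\<rparr>"
| "exec (Add i j k) c = c\<lparr>pc := pc c + 1, reg := (reg c)(i := reg c j + reg c k)\<rparr>"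
| "exec (Sub i j k) c = c\<lparr>pc := pc c + 1, reg := (reg c)(i := reg c j - reg c k)\<rparr>"
| "exec (Mul i j k) c = c\<lparr>pc := pc c + 1, reg := (reg c)(i := reg c j * reg c k)\<rparr>"
| "exec (Div i j k) c = c\<lparr>pc := pc c + 1, reg := (reg c)(i := reg c j / reg c k)\<rparr>"
| "exec (Jump_If_Less i j t) c = c\<lparr>pc := (if reg c i < reg c j then t else pc c + 1)\<rparr>"

definition machine_step :: "program \<Rightarrow> config \<Rightarrow> config" where
  "machine_step M c = (if pc c < length M then exec (M ! pc c) c else c)"

text \<open>The symbol 0 is the blank.\<close>

definition tape_of :: "cell list \<Rightarrow> int \<Rightarrow> cell" where
  "tape_of xs i = (if 0 \<le> i \<and> i < int (length xs) then xs ! nat i else Sym 0)"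

definition initial :: "cell list \<Rightarrow> config" where
  "initial xs = \<lparr>pc = 0, head = 0, tape = tape_of xs, reg = (\<lambda>_. 0)\<rparr>"

definition outputs_within :: "program \<Rightarrow> cell list \<Rightarrow> nat \<Rightarrow> cell list \<Rightarrow> bool" where
  "outputs_within M xs t ys \<longleftrightarrow>
     (let c = (machine_step M ^^ t) (initial xs) in length M \<le> pc c \<and> tape c = tape_of ys)"

text \<open>
  Arbitrary real weights have no finite description over a finite alphabet.
  The model \<open>Turing\<close> therefore works with weights that are rational or infinite,
  written in binary, and \<open>BSS\<close> with all weights, each occupying a single cell.
\<close>

datatype model = Turing | BSS

fun programs :: "model \<Rightarrow> program set" where
  "programs Turing = {M. \<forall>I \<in> set M. symbolic I}"
| "programs BSS = UNIV"

fun weights :: "model \<Rightarrow> ereal set" where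
  "weights Turing = insert \<infinity> (ereal ` \<rat>)"
| "weights BSS = insert \<infinity> (range ereal)"

definition polytime_on ::
    "model \<Rightarrow> ('a \<Rightarrow> cell list) \<Rightarrow> 'a set \<Rightarrow> ('a \<Rightarrow> 'a) \<Rightarrow> bool" where
  "polytime_on \<mu> enc D f \<longleftrightarrow>
     (\<exists>M \<in> programs \<mu>. \<exists>q :: nat poly. \<forall>x \<in> D.
        outputs_within M (enc x) (poly q (length (enc x))) (enc (f x)))"

section \<open>Written proofs\<close>

text \<open>
  A written proof lists the clauses of each formula, and the literals of each
  clause, in some order.
\<close>

type_synonym written_formula = "(literal list \<times> ereal) list"
type_synonym written_proof = "written_formula list"

definition formula_of :: "written_formula \<Rightarrow> formula" where
  "formula_of F = mset (map (\<lambda>(C, w). (clause_of C, w)) F)"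

text \<open>Least significant bit first, with the symbols 1 and 2 for the bits 0 and 1.\<close>

fun encode_nat :: "nat \<Rightarrow> cell list" where
  "encode_nat n = (if n = 0 then [] else Sym (1 + n mod 2) # encode_nat (n div 2))"

declare encode_nat.simps [simp del]

fun encode_literal :: "literal \<Rightarrow> cell list" where
  "encode_literal (Pos x) = Sym 3 # encode_nat x"
| "encode_literal (Neg x) = Sym 4 # encode_nat x"

definition encode_rat :: "rat \<Rightarrow> cell list" where
  "encode_rat q = (case quotient_of q of (a, b) \<Rightarrow>
     (if a < 0 then [Sym 8] else []) @ encode_nat (nat \<bar>a\<bar>) @ [Sym 9] @ encode_nat (nat b))"

fun encode_finite :: "model \<Rightarrow> real \<Rightarrow> cell list" where
  "encode_finite Turing r = encode_rat (inv real_of_rat r)"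
| "encode_finite BSS r = [Num r]"

definition encode_weight :: "model \<Rightarrow> ereal \<Rightarrow> cell list" where
  "encode_weight \<mu> w = (if w = \<infinity> then [Sym 10] else encode_finite \<mu> (real_of_ereal w))"

definition encode_formula :: "model \<Rightarrow> written_formula \<Rightarrow> cell list" where
  "encode_formula \<mu> F =
     concat (map (\<lambda>(C, w). concat (map encode_literal C) @ [Sym 5] @ encode_weight \<mu> w @ [Sym 6]) F)"

definition encode_proof :: "model \<Rightarrow> written_proof \<Rightarrow> cell list" where
  "encode_proof \<mu> Fs = concat (map (\<lambda>F. encode_formula \<mu> F @ [Sym 7]) Fs)"

definition written_refutation ::
    "model \<Rightarrow> proof_system \<Rightarrow> formula \<Rightarrow> written_proof \<Rightarrow> bool" where
  "written_refutation \<mu> \<Delta> F Fs \<longleftrightarrow>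
     refutation \<Delta> F (map formula_of Fs) \<and>
     (\<forall>G \<in> set Fs. \<forall>(C, w) \<in> set G. w \<in> weights \<mu>)"

section \<open>Comparing proof systems\<close>

definition p_simulates :: "model \<Rightarrow> proof_system \<Rightarrow> proof_system \<Rightarrow> bool" where
  "p_simulates \<mu> \<Delta> \<Gamma> \<longleftrightarrow>
     (\<exists>f. polytime_on \<mu> (encode_proof \<mu>) {Fs. \<exists>F. written_refutation \<mu> \<Gamma> F Fs} f \<and>
        (\<forall>F Fs. written_refutation \<mu> \<Gamma> F Fs \<longrightarrow> written_refutation \<mu> \<Delta> F (f Fs)))"

definition stronger :: "model \<Rightarrow> proof_system \<Rightarrow> proof_system \<Rightarrow> bool" where
  "stronger \<mu> \<Delta> \<Gamma> \<longleftrightarrow> p_simulates \<mu> \<Delta> \<Gamma> \<and> \<not> p_simulates \<mu> \<Gamma> \<Delta>"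

end

theory Submission
  imports Defs "HOL-Library.Nat_Bijection"
begin

text \<open>
  The separating formulas are the pigeonhole principles with \<open>n + 1\<close> pigeons and \<open>n\<close> holes, all
  clauses of weight 1.

  Upper bound. The virtual rule introduces \<open>(\<not> x\<^sub>i\<^sub>j, 1), (\<not> x\<^sub>i\<^sub>j, -1)\<close> for every pigeon \<open>i\<close> and hole
  \<open>j\<close>. Resolving the clause of pigeon \<open>i\<close> with the \<open>\<not> x\<^sub>i\<^sub>j\<close> of weight 1 gives a copy of the empty
  clause, \<open>n + 1\<close> copies in total. Conversely, one copy together with the clauses of hole \<open>j\<close> gives
  back all \<open>\<not> x\<^sub>i\<^sub>j\<close> of weight 1, which cancel the negative ones. One copy is left over.

  Lower bound. Without negative weights every clause of a proof follows from two clauses of the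
  preceding formula, so that Haken's bound for resolution applies, in the version of Beame and
  Pitassi. Measure a clause by the set of pigeons \<open>i\<close> such that some perfect matching of the holes
  that omits exactly pigeon \<open>i\<close> falsifies it. This set has at most one element initially, contains
  every pigeon for the empty clause, and at most doubles in size in an inference. So some clause has a
  set of medium size, and exchanging the omitted pigeon shows that this clause involves quadratically
  many edges. If the proof were small, then a greedily chosen partial matching would satisfy all
  clauses with many edges, and the same argument above this matching gives a contradiction.
\<close>

section \<open>Matchings and clauses\<close>

text \<open>The variable \<open>x\<^sub>i\<^sub>j\<close>: pigeon \<open>i\<close> sits in hole
  \<open>j\<close>. The pairing is a bijection, so every variable of an arbitrary proof has this
  form.\<close>

definition pvar :: "nat \<Rightarrow> nat \<Rightarrow> nat" where
  "pvar i j = prod_encode (i, j)"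

lemma pvar_inject [simp]: "pvar i j = pvar i' j' \<longleftrightarrow> i = i' \<and> j = j'"
  by (simp add: pvar_def)

lemma pvar_cases: obtains i j where "v = pvar i j"
  by (metis pvar_def prod_decode_inverse surj_pair)

text \<open>Matchings are maps from holes to pigeons, since all holes are filled while one pigeon
  stays outside. Variables of holes from \<open>n\<close> on are false.\<close>

definition matching_assignment :: "nat \<Rightarrow> (nat \<Rightarrow> nat) \<Rightarrow> nat \<Rightarrow> bool" where
  "matching_assignment n h v \<longleftrightarrow> (case prod_decode v of (i, j) \<Rightarrow> j < n \<and> h j = i)"

lemma matching_assignment_pvar [simp]:
  "matching_assignment n h (pvar i j) \<longleftrightarrow> j < n \<and> h j = i"
  by (simp add: matching_assignment_def pvar_def)

text \<open>The edges whose presence in a matching of all holes makes \<open>C\<close> true: a negative literal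
  \<open>\<not> x\<^sub>l\<^sub>j\<close> says that a pigeon other than \<open>l\<close> sits in hole \<open>j\<close>.\<close>

definition edges :: "clause \<Rightarrow> (nat \<times> nat) set" where
  "edges C = {(i, j). Pos (pvar i j) |\<in>| C \<or> (\<exists>l. l \<noteq> i \<and> Neg (pvar l j) |\<in>| C)}"

lemma not_falsifies_if_edge:
  assumes "(h j, j) \<in> edges C" "j < n"
  shows "\<not> falsifies (matching_assignment n h) C"
proof -
  from assms(1) consider "Pos (pvar (h j) j) |\<in>| C" | l where "l \<noteq> h j" "Neg (pvar l j) |\<in>| C"
    by (auto simp: edges_def)
  then show ?thesis
  proof cases
    case 1
    then show ?thesis using assms(2) unfolding falsifies_def
      by (metis lit_true.simps(1) matching_assignment_pvar)
  next
    case 2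
    then show ?thesis unfolding falsifies_def
      by (metis lit_true.simps(2) matching_assignment_pvar)
  qed
qed

text \<open>Only variables of hole \<open>j\<close> change. The literal that becomes true is either
  the positive one of the incoming pigeon \<open>i\<close> or the negative one of the outgoing
  pigeon \<open>h j\<close>, and both count as the edge \<open>(i, j)\<close>.\<close>

lemma edge_if_move_satisfies:
  assumes "falsifies (matching_assignment n h) C"
    and "\<not> falsifies (matching_assignment n (h(j := i))) C" and "h j \<noteq> i"
  shows "(i, j) \<in> edges C"
proof -
  obtain l where l: "l |\<in>| C" "lit_true (matching_assignment n (h(j := i))) l"
    "\<not> lit_true (matching_assignment n h) l"
    using assms(1,2) by (auto simp: falsifies_def)
  show ?thesis
  proof (cases l)
    case (Pos v)
    obtain i' j' where "v = pvar i' j'" by (rule pvar_cases)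
    with Pos l show ?thesis by (auto simp: edges_def split: if_splits)
  next
    case (Neg v)
    obtain i' j' where "v = pvar i' j'" by (rule pvar_cases)
    with Neg l assms(3) show ?thesis by (auto simp: edges_def split: if_splits)
  qed
qed

text \<open>Here \<open>h j\<close> is the pigeon in hole \<open>j\<close>, and \<open>h\<close> extends the partial matching \<open>r\<close> of the
  holes in \<open>D\<close>.\<close>

definition critical :: "nat \<Rightarrow> nat set \<Rightarrow> (nat \<Rightarrow> nat) \<Rightarrow> (nat \<Rightarrow> nat) \<Rightarrow> bool" where
  "critical n D r h \<longleftrightarrow> inj_on h {..<n} \<and> h ` {..<n} \<subseteq> {..n} \<and> (\<forall>j \<in> D. h j = r j)"

text \<open>The measure of a clause in Haken's argument, taken relative to a fixed partial
  matching.\<close>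

definition missed :: "nat \<Rightarrow> nat set \<Rightarrow> (nat \<Rightarrow> nat) \<Rightarrow> clause \<Rightarrow> nat set" where
  "missed n D r C = {i. i \<le> n \<and> (\<exists>h. critical n D r h \<and> i \<notin> h ` {..<n} \<and>
     falsifies (matching_assignment n h) C)}"

definition free_edges :: "nat \<Rightarrow> nat set \<Rightarrow> (nat \<Rightarrow> nat) \<Rightarrow> (nat \<times> nat) set" where
  "free_edges n D r = ({..n} - r ` D) \<times> ({..<n} - D)"

lemma finite_missed [simp]: "finite (missed n D r C)"
  by (rule finite_subset[of _ "{..n}"]) (auto simp: missed_def)

lemma missed_subset_free: "D \<subseteq> {..<n} \<Longrightarrow> missed n D r C \<subseteq> {..n} - r ` D"
  by (auto simp: missed_def critical_def) (metis imageI lessThan_iff subsetD)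

section \<open>Exchanging the omitted pigeon\<close>

lemma critical_image:
  assumes "critical n D r h" "i \<le> n" "i \<notin> h ` {..<n}"
  shows "h ` {..<n} = {..n} - {i}"
proof (rule card_subset_eq)
  show "h ` {..<n} \<subseteq> {..n} - {i}" using assms by (auto simp: critical_def)
  have "card (h ` {..<n}) = n" using assms by (simp add: critical_def card_image)
  then show "card (h ` {..<n}) = card ({..n} - {i})" using assms(2) by simp
qed simp

text \<open>An edge of the fixed matching makes the clause true under every extension, so clauses
  hit by the matching have measure zero.\<close>

lemma missed_hit:
  assumes "j \<in> D" "D \<subseteq> {..<n}" "(r j, j) \<in> edges C"
  shows "missed n D r C = {}"
proof -
  have "\<not> falsifies (matching_assignment n h) C" if "critical n D r h" for h
    using that assms by (intro not_falsifies_if_edge[of h j]) (auto simp: critical_def)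
  then show ?thesis by (auto simp: missed_def)
qed

text \<open>The omitted pigeon takes over hole \<open>j\<close>, and the former occupant becomes the
  omitted one.\<close>

lemma critical_move:
  assumes h: "critical n D r h" and i: "i \<le> n" "i \<notin> h ` {..<n}" and j: "j < n" "j \<notin> D"
  shows "critical n D r (h(j := i))" "h j \<notin> (h(j := i)) ` {..<n}"
proof -
  have inj: "inj_on h {..<n}" using h by (simp add: critical_def)
  have "inj_on (h(j := i)) {..<n}"
    using inj i(2) by (intro inj_on_fun_updI) auto
  then show "critical n D r (h(j := i))" using h i j by (auto simp: critical_def)
  have "h j \<noteq> i" using i j by auto
  then show "h j \<notin> (h(j := i)) ` {..<n}" using inj j by (auto simp: inj_on_def split: if_splits)
qed

text \<open>Let \<open>i\<close> be missed and let \<open>k\<close> be free but not missed. In a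
  falsifying matching that omits \<open>i\<close>, pigeon \<open>k\<close> sits in some hole
  \<open>j\<close>. Letting \<open>i\<close> replace \<open>k\<close> there omits \<open>k\<close>,
  hence makes \<open>C\<close> true, so \<open>(i, j)\<close> is an edge of
  \<open>C\<close>.\<close>

lemma card_free_edges_ge:
  assumes D: "D \<subseteq> {..<n}"
  shows "card (missed n D r C) * card ({..n} - r ` D - missed n D r C)
    \<le> card (edges C \<inter> free_edges n D r)"
proof -
  let ?M = "missed n D r C" and ?K = "{..n} - r ` D - missed n D r C"
  have "\<exists>j. (i, j) \<in> edges C \<inter> free_edges n D r \<and> h j = k"
    if h: "critical n D r h" "i \<le> n" "i \<notin> h ` {..<n}" "falsifies (matching_assignment n h) C"
      and i: "i \<in> ?M" and k: "k \<in> ?K" for i h k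
  proof -
    have "k \<in> h ` {..<n}" using critical_image[OF h(1-3)] i k by auto
    then obtain j where j: "j < n" "k = h j" by auto
    have jD: "j \<notin> D" using h(1) k j by (auto simp: critical_def)
    have "\<not> falsifies (matching_assignment n (h(j := i))) C"
    proof
      assume "falsifies (matching_assignment n (h(j := i))) C"
      then have "k \<in> ?M"
        using critical_move[OF h(1-3) j(1) jD] k j(2) unfolding missed_def by blast
      then show False using k by blast
    qed
    moreover have "h j \<noteq> i" using h(3) j by auto
    ultimately have "(i, j) \<in> edges C" using edge_if_move_satisfies h(4) by blast
    moreover have "i \<in> {..n} - r ` D" using missed_subset_free[OF D] i by blast
    ultimately show ?thesis using j jD by (auto simp: free_edges_def)
  qed
  moreover have "\<forall>i \<in> ?M. \<exists>h. critical n D r h \<and> i \<le> n \<and> i \<notin> h ` {..<n} \<and>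
      falsifies (matching_assignment n h) C"
    by (auto simp: missed_def)
  \<comment> \<open>One witness is fixed per missed pigeon, so that \<open>k\<close> can be
    recovered from the edge \<open>(i, j)\<close> as \<open>H i j\<close>. This makes the pairs
    \<open>(i, k)\<close> an image of the edges.\<close>
  then obtain H where "\<forall>i \<in> ?M. critical n D r (H i) \<and> i \<le> n \<and> i \<notin> H i ` {..<n} \<and>
      falsifies (matching_assignment n (H i)) C"
    by metis
  ultimately have "\<exists>j. (i, j) \<in> edges C \<inter> free_edges n D r \<and> H i j = k"
    if "i \<in> ?M" "k \<in> ?K" for i k
    using that by blast
  note * = this
  have sub: "?M \<times> ?K \<subseteq> (\<lambda>(i, j). (i, H i j)) ` (edges C \<inter> free_edges n D r)"
  proof
    fix p assume "p \<in> ?M \<times> ?K"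
    then obtain i k where ik: "p = (i, k)" "i \<in> ?M" "k \<in> ?K" by (rule SigmaE)
    obtain j where "(i, j) \<in> edges C \<inter> free_edges n D r" "H i j = k"
      using *[OF ik(2,3)] by (elim exE conjE)
    then show "p \<in> (\<lambda>(i, j). (i, H i j)) ` (edges C \<inter> free_edges n D r)"
      using ik(1) by (intro image_eqI[of _ _ "(i, j)"]) simp_all
  qed
  have fin: "finite (edges C \<inter> free_edges n D r)"
    by (simp add: free_edges_def)
  with sub have "card (?M \<times> ?K) \<le> card ((\<lambda>(i, j). (i, H i j)) ` (edges C \<inter> free_edges n D r))"
    by (intro card_mono finite_imageI)
  also have "\<dots> \<le> card (edges C \<inter> free_edges n D r)"
    using fin by (rule card_image_le)
  finally show ?thesis by (simp add: card_cartesian_product)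
qed

text \<open>Once a free pigeon \<open>i\<close> is set aside, the remaining free pigeons are as many
  as the free holes. Any bijection between them extends \<open>r\<close> to a matching that omits
  \<open>i\<close>.\<close>

lemma missed_empty_clause:
  assumes D: "D \<subseteq> {..<n}" and r: "inj_on r D" "r ` D \<subseteq> {..n}"
  shows "missed n D r {||} = {..n} - r ` D"
proof
  show "{..n} - r ` D \<subseteq> missed n D r {||}"
  proof
    fix i assume i: "i \<in> {..n} - r ` D"
    have fD: "finite D" using D finite_subset by blast
    have "card ({..n} - r ` D - {i}) = Suc n - card D - 1"
      using i r fD by (simp add: card_Diff_subset card_image)
    also have "\<dots> = card ({..<n} - D)" using D fD by (simp add: card_Diff_subset)
    finally have "card ({..<n} - D) = card ({..n} - r ` D - {i})" ..
    then obtain g where g: "bij_betw g ({..<n} - D) ({..n} - r ` D - {i})"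
      using finite_same_card_bij[of "{..<n} - D" "{..n} - r ` D - {i}"] by auto
    define h where "h j = (if j \<in> D then r j else g j)" for j
    have gi: "g ` ({..<n} - D) = {..n} - r ` D - {i}" "inj_on g ({..<n} - D)"
      using g by (auto simp: bij_betw_def)
    have "inj_on h (D \<union> ({..<n} - D))"
    proof (subst inj_on_Un, intro conjI)
      show "inj_on h D" using r by (simp add: h_def inj_on_def)
      show "inj_on h ({..<n} - D)" using gi(2) by (simp add: h_def inj_on_def)
      have "h ` D = r ` D" by (simp add: h_def)
      moreover have "h ` ({..<n} - D) = g ` ({..<n} - D)" by (auto simp: h_def)
      ultimately show "h ` (D - ({..<n} - D)) \<inter> h ` ({..<n} - D - D) = {}"
        using gi(1) by auto
    qed
    moreover have "D \<union> ({..<n} - D) = {..<n}" using D by auto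
    ultimately have "inj_on h {..<n}" by simp
    moreover have "h j \<le> n \<and> h j \<noteq> i" if "j < n" for j
    proof (cases "j \<in> D")
      case True then show ?thesis using r i by (auto simp: h_def)
    next
      case False
      then have "g j \<in> {..n} - r ` D - {i}" using gi(1) that by blast
      then show ?thesis using False by (simp add: h_def)
    qed
    moreover have "\<forall>j \<in> D. h j = r j" by (simp add: h_def)
    ultimately have "critical n D r h" "i \<notin> h ` {..<n}" by (auto simp: critical_def)
    then show "i \<in> missed n D r {||}" using i by (auto simp: missed_def falsifies_def)
  qed
qed (rule missed_subset_free[OF D])

section \<open>Greedy choice of a partial matching\<close>

lemma popular_element:
  fixes f :: "'c \<Rightarrow> 'e set"
  assumes "finite U" "finite S" "S \<noteq> {}" "\<And>c. c \<in> U \<Longrightarrow> T \<le> card (f c \<inter> S)"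
    and "card S \<le> k * T"
  shows "\<exists>x \<in> S. card U \<le> k * card {c \<in> U. x \<in> f c}"
proof (rule ccontr)
  assume "\<not> ?thesis"
  \<comment> \<open>Averaging: the pairs of a member of \<open>U\<close> and an element of
    \<open>S\<close> related by \<open>f\<close> are counted in two ways.\<close>
  then have "(\<Sum>x\<in>S. k * card {c \<in> U. x \<in> f c}) < (\<Sum>x\<in>S. card U)"
    using assms by (intro sum_strict_mono) (auto simp: not_le)
  also have "\<dots> \<le> k * (T * card U)" using assms(5) by (simp add: mult_le_mono1 flip: mult.assoc)
  also have "T * card U \<le> (\<Sum>c\<in>U. card (f c \<inter> S))"
    using sum_bounded_below[of U T "\<lambda>c. card (f c \<inter> S)"] assms(4) by (simp add: mult.commute)
  also have "\<dots> = (\<Sum>c\<in>U. \<Sum>x\<in>S. if x \<in> f c then 1 else 0)"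
    using assms(2) by (intro sum.cong) (auto simp: sum.If_cases Int_commute)
  also have "\<dots> = (\<Sum>x\<in>S. \<Sum>c\<in>U. if x \<in> f c then 1 else 0)" by (rule sum.swap)
  also have "\<dots> = (\<Sum>x\<in>S. card {c \<in> U. x \<in> f c})"
    using assms(1) by (intro sum.cong) (auto simp: sum.If_cases Collect_conj_eq Int_commute)
  finally show False by (simp add: sum_distrib_left)
qed

text \<open>A clause is large if it has at least \<open>T\<close> free edges. Since there are at
  most \<open>36 * T\<close> free edges, some edge lies in at least 1/36 of the large clauses not
  yet hit. Adding it to the matching leaves at most 35/36 of them, and this is repeated
  \<open>t\<close> times.\<close>

lemma matching_hitting_large_clauses:
  assumes fin: "finite \<C>" and T: "n * Suc n \<le> 36 * T" and "t \<le> n"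
  shows "\<exists>D r. D \<subseteq> {..<n} \<and> card D = t \<and> inj_on r D \<and> r ` D \<subseteq> {..n} \<and>
    36 ^ t * card {C \<in> \<C>. (\<forall>j \<in> D. (r j, j) \<notin> edges C) \<and>
      T \<le> card (edges C \<inter> free_edges n D r)} \<le> 35 ^ t * card \<C>"
  using \<open>t \<le> n\<close>
proof (induction t)
  case 0
  have "card {C \<in> \<C>. T \<le> card (edges C \<inter> free_edges n {} r)} \<le> card \<C>" for r
    using fin by (intro card_mono) auto
  then show ?case by (intro exI[of _ "{}"]) simp
next
  case (Suc t)
  then obtain D r where D: "D \<subseteq> {..<n}" "card D = t" and r: "inj_on r D" "r ` D \<subseteq> {..n}"
    and IH: "36 ^ t * card {C \<in> \<C>. (\<forall>j \<in> D. (r j, j) \<notin> edges C) \<and>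
      T \<le> card (edges C \<inter> free_edges n D r)} \<le> 35 ^ t * card \<C>" (is "_ * card ?U \<le> _")
    by auto
  have fD: "finite D" using D finite_subset by blast
  have S: "finite (free_edges n D r)" by (simp add: free_edges_def)
  \<comment> \<open>A free hole and a free pigeon remain because fewer than \<open>n\<close> holes
    are matched.\<close>
  have ne: "free_edges n D r \<noteq> {}"
  proof -
    have "card ({..<n} - D) > 0" using D fD Suc.prems by (simp add: card_Diff_subset)
    moreover have "card ({..n} - r ` D) > 0"
      using D fD r Suc.prems by (simp add: card_Diff_subset card_image)
    ultimately have "{..<n} - D \<noteq> {}" "{..n} - r ` D \<noteq> {}" by (metis card.empty less_numeral_extra(3))+
    then show ?thesis unfolding free_edges_def by blast
  qed
  have "card (free_edges n D r) \<le> card ({..n} \<times> {..<n})"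
    by (intro card_mono) (auto simp: free_edges_def)
  then have "card (free_edges n D r) \<le> 36 * T" using T by (simp add: card_cartesian_product mult.commute)
  then obtain e where e: "e \<in> free_edges n D r" "card ?U \<le> 36 * card {C \<in> ?U. e \<in> edges C}"
    using popular_element[OF _ S ne, of ?U T edges 36] fin by fastforce
  obtain i j where ij: "e = (i, j)" by force
  have i: "i \<le> n" "i \<notin> r ` D" and j: "j < n" "j \<notin> D" using e(1) by (auto simp: ij free_edges_def)
  define D' r' where "D' = insert j D" and "r' = r(j := i)"
  have eqr: "r' ` D = r ` D" using j by (auto simp: r'_def)
  have D': "D' \<subseteq> {..<n}" "card D' = Suc t" using D j fD by (auto simp: D'_def)
  have r': "inj_on r' D'" "r' ` D' \<subseteq> {..n}"
    using r i j eqr by (auto simp: D'_def r'_def inj_on_def)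
  let ?U' = "{C \<in> \<C>. (\<forall>j \<in> D'. (r' j, j) \<notin> edges C) \<and> T \<le> card (edges C \<inter> free_edges n D' r')}"
  have "?U' \<subseteq> ?U - {C \<in> ?U. e \<in> edges C}"
  proof
    fix C assume C: "C \<in> ?U'"
    \<comment> \<open>Free edges only disappear, so a clause that is large after this round was
      large before it.\<close>
    have "free_edges n D' r' \<subseteq> free_edges n D r"
      using eqr by (auto simp: free_edges_def D'_def)
    then have "card (edges C \<inter> free_edges n D' r') \<le> card (edges C \<inter> free_edges n D r)"
      using S by (intro card_mono) auto
    moreover have "(r k, k) \<notin> edges C" if "k \<in> D" for k
    proof -
      have "r' k = r k" "k \<in> D'" using that j by (auto simp: r'_def D'_def)
      then show ?thesis using C by fastforce
    qed
    moreover have "(i, j) \<notin> edges C" using C by (auto simp: D'_def r'_def)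
    ultimately show "C \<in> ?U - {C \<in> ?U. e \<in> edges C}" using C ij by auto
  qed
  then have "card ?U' \<le> card (?U - {C \<in> ?U. e \<in> edges C})" using fin by (intro card_mono) auto
  also have "\<dots> = card ?U - card {C \<in> ?U. e \<in> edges C}"
    using fin by (intro card_Diff_subset) auto
  finally have "36 * card ?U' \<le> 35 * card ?U" using e(2) by linarith
  then have "36 ^ t * (36 * card ?U') \<le> 36 ^ t * (35 * card ?U)" by (rule mult_le_mono2)
  also have "\<dots> \<le> 35 * (35 ^ t * card \<C>)" using IH by simp
  finally have "36 ^ Suc t * card ?U' \<le> 35 ^ Suc t * card \<C>" by (simp add: mult.assoc mult.left_commute)
  then show ?case using D' r' by (intro exI[of _ D'] exI[of _ r'] conjI)
qed

section \<open>Soundness of proofs with positive weights\<close>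

definition clauses :: "formula \<Rightarrow> clause set" where
  "clauses F = fst ` set_mset F"

lemma finite_clauses [simp]: "finite (clauses F)"
  by (simp add: clauses_def)

lemma clauses_simps [simp]:
  "clauses {#} = {}" "clauses (add_mset (C, w) F) = insert C (clauses F)"
  "clauses (F + G) = clauses F \<union> clauses G"
  by (auto simp: clauses_def)

lemma maxsat_formula_simps [simp]:
  "maxsat_formula {#}" "maxsat_formula (add_mset (C, w) F) \<longleftrightarrow> 0 < w \<and> maxsat_formula F"
  "maxsat_formula (F + G) \<longleftrightarrow> maxsat_formula F \<and> maxsat_formula G"
  by (auto simp: maxsat_formula_def)

text \<open>Merging positive weights never yields 0, so no clause vanishes. Parts of a positive
  weight share their sign, so they are positive.\<close>

lemma regroup1_positive:
  "regroup1 F G \<Longrightarrow> maxsat_formula F \<Longrightarrow> maxsat_formula G \<and> clauses G = clauses F"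
proof (induction rule: regroup1.induct)
  case (merge H C u v)
  then have "0 < u + v" by (auto intro: add_pos_pos)
  then show ?case using merge by (auto simp: weighted_def)
next
  case (divide u v H C)
  then have "\<not> (u < 0 \<and> v < 0)"
    by (metis add_neg_neg maxsat_formula_simps(2,3) not_less_iff_gr_or_eq)
  then show ?case using divide by auto
qed

lemma regroup_positive:
  "regroup F G \<Longrightarrow> maxsat_formula F \<Longrightarrow> maxsat_formula G \<and> clauses G = clauses F"
  by (induction rule: rtranclp_induct) (use regroup1_positive in blast)+

text \<open>The recursion only enlarges \<open>E\<close>, so all by-products of a resolution step
  are weakenings of a parent clause.\<close>

lemma in_or_not:
  "(C, w) \<in># or_not E D u \<Longrightarrow> w = u \<and> set E \<subseteq> fset C"
  by (induction E D u rule: or_not.induct)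
    (auto simp: weighted_def fset_of_list.rep_eq split: if_splits)

lemma falsifies_mono: "C |\<subseteq>| D \<Longrightarrow> falsifies X D \<Longrightarrow> falsifies X C"
  by (auto simp: falsifies_def)

text \<open>The case \<open>D1 = D2\<close> covers weakening, and two premises cover the resolvent.
  The limit of two is what makes measures at most double.\<close>

definition implied :: "clause set \<Rightarrow> clause \<Rightarrow> bool" where
  "implied \<C> C \<longleftrightarrow>
     (\<exists>D1 \<in> \<C>. \<exists>D2 \<in> \<C>. \<forall>X. falsifies X C \<longrightarrow> falsifies X D1 \<or> falsifies X D2)"

lemma implied_by_subclause: "D \<in> \<C> \<Longrightarrow> D |\<subseteq>| C \<Longrightarrow> implied \<C> C"
  unfolding implied_def using falsifies_mono by blast

lemma implied_mono: "implied \<C> C \<Longrightarrow> \<C> \<subseteq> \<D> \<Longrightarrow> implied \<D> C"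
  unfolding implied_def by blast

text \<open>Every consequent is the resolvent or contains a parent. The weights \<open>m\<close>,
  \<open>v - m\<close> and \<open>w - m\<close> are nonnegative, and \<open>weighted\<close> removes
  those equal to 0.\<close>

lemma resolution_positive:
  assumes "resolution P Q"
  shows "maxsat_formula Q \<and> (\<forall>C \<in> clauses Q. implied (clauses P) C)"
  using assms
proof cases
  case (1 v w m A x B)
  have "0 < m" "m \<le> v" "m \<le> w" using 1 by (auto simp: min_def)
  then have pos: "0 \<le> v - m" "0 \<le> w - m" by (simp_all add: ereal_diff_positive)
  have res: "implied (clauses P) (clause_of (A @ B))"
    unfolding implied_def
  proof (intro bexI allI impI)
    fix X assume "falsifies X (clause_of (A @ B))"
    then show "falsifies X (clause_of (Pos x # A)) \<or> falsifies X (clause_of (Neg x # B))"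
      by (cases "X x") (auto simp: falsifies_def fset_of_list.rep_eq)
  qed (simp_all add: 1)
  have "0 < u \<and> implied (clauses P) C" if "(C, u) \<in># Q" for C u
  proof -
    have u: "(C, u) \<in># weighted (clause_of (A @ B)) m \<or>
        (C, u) \<in># weighted (clause_of (Pos x # A)) (v - m) \<or>
        (C, u) \<in># weighted (clause_of (Neg x # B)) (w - m) \<or>
        (C, u) \<in># or_not (Pos x # A) B m \<or> (C, u) \<in># or_not (Neg x # B) A m"
      using that by (auto simp: 1 discard_tautologies_def)
    have "0 < u" using u \<open>0 < m\<close> pos
      by (auto simp: weighted_def order_less_le split: if_splits dest!: in_or_not)
    moreover have "C = clause_of (A @ B) \<or> set (Pos x # A) \<subseteq> fset C \<or> set (Neg x # B) \<subseteq> fset C"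
      using u by (auto simp: weighted_def fset_of_list.rep_eq split: if_splits dest!: in_or_not)
    then have "C = clause_of (A @ B) \<or> clause_of (Pos x # A) |\<subseteq>| C \<or> clause_of (Neg x # B) |\<subseteq>| C"
      by (simp add: less_eq_fset.rep_eq fset_of_list.rep_eq)
    ultimately show ?thesis using res
      by (auto simp: 1 intro: implied_by_subclause)
  qed
  then show ?thesis by (auto simp: maxsat_formula_def clauses_def)
qed

lemma split_positive:
  assumes "split P Q"
  shows "maxsat_formula Q \<and> (\<forall>C \<in> clauses Q. implied (clauses P) C)"
  using assms by cases (auto intro: implied_by_subclause)

lemma ResS_step_positive:
  assumes "proof_step ResS F G" "maxsat_formula F"
  shows "maxsat_formula G \<and> (\<forall>C \<in> clauses G. implied (clauses F) C)"
proof -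
  obtain P Q H where PQ: "resolution P Q \<or> split P Q"
    and F: "regroup F (P + H)" and G: "regroup (Q + H) G"
    using assms(1) by (auto simp: proof_step_def ResS_def)
  have "maxsat_formula (P + H)" "clauses (P + H) = clauses F"
    using regroup_positive[OF F assms(2)] by auto
  moreover have Q: "maxsat_formula Q" "\<forall>C \<in> clauses Q. implied (clauses P) C"
    using PQ resolution_positive split_positive by blast+
  ultimately have "maxsat_formula G" "clauses G = clauses Q \<union> clauses H"
    using regroup_positive[OF G] by auto
  moreover have "implied (clauses F) C" if "C \<in> clauses Q \<union> clauses H" for C
    using that Q(2) \<open>clauses (P + H) = clauses F\<close>
    by (auto intro: implied_mono implied_by_subclause)
  ultimately show ?thesis by blast
qed

lemma ResS_proof_positive:
  assumes "is_proof ResS Fs" "maxsat_formula (hd Fs)" "F \<in> set Fs"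
  shows "maxsat_formula F"
proof -
  have "maxsat_formula (Fs ! i)" if "i < length Fs" for i
    using that
  proof (induction i)
    case 0
    then show ?case using assms by (simp add: hd_conv_nth)
  next
    case (Suc i)
    then have "proof_step ResS (Fs ! i) (Fs ! Suc i)" using assms by (simp add: is_proof_def)
    then show ?case using Suc ResS_step_positive by simp
  qed
  then show ?thesis using assms(3) by (metis in_set_conv_nth)
qed

section \<open>Clauses of medium measure\<close>

lemma missed_implied:
  assumes "implied \<C> C"
  obtains D1 D2 where "D1 \<in> \<C>" "D2 \<in> \<C>" "missed n D r C \<subseteq> missed n D r D1 \<union> missed n D r D2"
  using assms unfolding implied_def missed_def by blast

text \<open>A matching that falsifies a clause falsifies one of its two premises and omits the same
  pigeon, so the measure is subadditive. It cannot pass from below \<open>a\<close> to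
  \<open>2 * a\<close> or more in one inference.\<close>

lemma medium_clause_exists:
  assumes "is_proof ResS Fs" "maxsat_formula (hd Fs)"
    and init: "\<And>C. C \<in> clauses (hd Fs) \<Longrightarrow> card (missed n D r C) < a"
    and final: "C \<in> clauses (last Fs)" "a \<le> card (missed n D r C)"
  obtains F C where "F \<in> set Fs" "C \<in> clauses F"
    "a \<le> card (missed n D r C)" "card (missed n D r C) < 2 * a"
proof (rule ccontr)
  assume "\<not> thesis"
  \<comment> \<open>If no clause has its measure between \<open>a\<close> and \<open>2 * a\<close>,
    then a measure below \<open>2 * a\<close> is already below \<open>a\<close>.\<close>
  with that have no: "card (missed n D r C) < a"
    if "F \<in> set Fs" "C \<in> clauses F" "card (missed n D r C) < 2 * a" for F C
    using that by (meson not_le)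
  have "\<forall>C \<in> clauses (Fs ! i). card (missed n D r C) < a"
    if "i < length Fs" for i
    using that
  proof (induction i)
    case 0
    then show ?case using init by (simp add: hd_conv_nth)
  next
    case (Suc i)
    then have IH: "\<forall>C \<in> clauses (Fs ! i). card (missed n D r C) < a" by simp
    have step: "proof_step ResS (Fs ! i) (Fs ! Suc i)"
      using Suc.prems assms(1) by (simp add: is_proof_def)
    have pos: "maxsat_formula (Fs ! i)"
      using ResS_proof_positive[OF assms(1,2)] Suc.prems by simp
    show ?case
    proof
      fix C assume C: "C \<in> clauses (Fs ! Suc i)"
      have "implied (clauses (Fs ! i)) C" using ResS_step_positive[OF step pos] C by blast
      then obtain D1 D2 where D12: "D1 \<in> clauses (Fs ! i)" "D2 \<in> clauses (Fs ! i)"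
        and sub: "missed n D r C \<subseteq> missed n D r D1 \<union> missed n D r D2"
        by (rule missed_implied)
      have "card (missed n D r C) \<le> card (missed n D r D1 \<union> missed n D r D2)"
        using sub by (intro card_mono) auto
      also have "\<dots> \<le> card (missed n D r D1) + card (missed n D r D2)" by (rule card_Un_le)
      also have "\<dots> < 2 * a" using bspec[OF IH D12(1)] bspec[OF IH D12(2)] by simp
      finally show "card (missed n D r C) < a" by (rule no[OF nth_mem[OF Suc.prems] C])
    qed
  qed
  moreover have "Fs \<noteq> []" using assms(1) by (simp add: is_proof_def)
  ultimately have "\<forall>C \<in> clauses (last Fs). card (missed n D r C) < a"
    unfolding last_conv_nth[OF \<open>Fs \<noteq> []\<close>] by (meson diff_less length_greater_0_conv zero_less_one)
  then show False using final by auto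
qed

section \<open>The pigeonhole principle\<close>

text \<open>Smaller values of \<open>n\<close> give the intermediate clauses of the refutation, in
  which the last holes have been resolved away.\<close>

definition pigeon_clause :: "nat \<Rightarrow> nat \<Rightarrow> clause" where
  "pigeon_clause n i = clause_of (map (\<lambda>j. Pos (pvar i j)) [0..<n])"

definition hole_clause :: "nat \<Rightarrow> nat \<Rightarrow> nat \<Rightarrow> clause" where
  "hole_clause j k i = {|Neg (pvar i j), Neg (pvar k j)|}"

text \<open>Pigeons are numbered from 0 to \<open>n\<close>. Each pair of pigeons is listed once,
  under the larger one, which matches the induction in \<open>derives_hole\<close>.\<close>

definition PHP :: "nat \<Rightarrow> formula" where
  "PHP n = (\<Sum>i\<le>n. {#(pigeon_clause n i, 1)#}) +
     (\<Sum>j<n. \<Sum>k\<le>n. \<Sum>i<k. {#(hole_clause j k i, 1)#})"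

lemma falsifies_pigeon_clause:
  "falsifies X (pigeon_clause n i) \<longleftrightarrow> (\<forall>j<n. \<not> X (pvar i j))"
  by (force simp: falsifies_def pigeon_clause_def fset_of_list.rep_eq)

lemma falsifies_hole_clause:
  "falsifies X (hole_clause j k i) \<longleftrightarrow> X (pvar i j) \<and> X (pvar k j)"
  by (auto simp: falsifies_def hole_clause_def)

lemma in_sum_mset_iff: "finite A \<Longrightarrow> x \<in># sum f A \<longleftrightarrow> (\<exists>a \<in> A. x \<in># f a)"
  by (induction A rule: finite_induct) auto

lemma in_PHP_iff:
  "(C, w) \<in># PHP n \<longleftrightarrow> w = 1 \<and> ((\<exists>i\<le>n. C = pigeon_clause n i) \<or>
     (\<exists>j<n. \<exists>k\<le>n. \<exists>i<k. C = hole_clause j k i))"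
  by (auto simp: PHP_def in_sum_mset_iff)

lemma maxsat_formula_PHP: "maxsat_formula (PHP n)"
  by (auto simp: maxsat_formula_def in_PHP_iff)

lemma cost_simps [simp]:
  "cost {#} X = 0" "cost (add_mset (C, w) F) X = (if falsifies X C then w else 0) + cost F X"
  "cost (F + G) X = cost F X + cost G X"
  by (simp_all add: cost_def)

lemma cost_sum: "finite A \<Longrightarrow> cost (sum f A) X = (\<Sum>a\<in>A. cost (f a) X)"
  by (induction A rule: finite_induct) auto

lemma cost_nonneg: "maxsat_formula F \<Longrightarrow> 0 \<le> cost F X"
  by (induction F) auto

lemma cost_pos: "maxsat_formula F \<Longrightarrow> (C, w) \<in># F \<Longrightarrow> falsifies X C \<Longrightarrow> 0 < cost F X"
proof -
  assume F: "maxsat_formula F" and C: "(C, w) \<in># F" "falsifies X C"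
  obtain H where H: "F = add_mset (C, w) H" using C(1) by (metis insert_DiffM)
  then show "0 < cost F X" using F C(2) cost_nonneg[of H X] by (simp add: add_pos_nonneg)
qed

lemma PHP_unsatisfiable: "\<exists>C. (C, 1) \<in># PHP n \<and> falsifies X C"
proof (rule ccontr)
  assume no: "\<not> ?thesis"
  then have "\<forall>i \<in> {..n}. \<exists>j. j < n \<and> X (pvar i j)"
    using falsifies_pigeon_clause by (fastforce simp: in_PHP_iff)
  then obtain g where g: "\<forall>i \<in> {..n}. g i < n \<and> X (pvar i (g i))" by metis
  have ne: "g i \<noteq> g k" if "i < k" "k \<le> n" for i k
  proof
    assume eq: "g i = g k"
    have "(hole_clause (g k) k i, 1) \<in># PHP n" using that g unfolding in_PHP_iff by (metis atMost_iff)
    moreover have "falsifies X (hole_clause (g k) k i)"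
      using that g eq by (metis atMost_iff falsifies_hole_clause less_imp_le order_trans)
    ultimately show False using no by blast
  qed
  have "inj_on g {..n}" by (rule linorder_inj_onI) (use ne in auto)
  moreover have "g ` {..n} \<subseteq> {..<n}" using g by auto
  ultimately have "card {..n} \<le> card {..<n}" by (metis card_inj_on_le finite_lessThan)
  then show False by simp
qed

text \<open>This ensures that a refutation really ends with an empty clause, since a target of
  weight 0 would disappear.\<close>

lemma MaxSAT_PHP_pos: "0 < MaxSAT (PHP n)"
proof -
  have "MaxSAT (PHP n) \<in> range (cost (PHP n))"
    unfolding MaxSAT_def by (intro Min_in finite_range_cost) auto
  then show ?thesis using PHP_unsatisfiable maxsat_formula_PHP cost_pos by (metis rangeE)
qed

text \<open>Put pigeon \<open>i\<close> into hole \<open>i\<close>; only the clause of pigeon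
  \<open>n\<close> is falsified. Hence one empty clause of weight 1 is enough for a
  refutation.\<close>

lemma MaxSAT_PHP_le: "MaxSAT (PHP n) \<le> 1"
proof -
  let ?X = "matching_assignment n (\<lambda>j. j)"
  have "falsifies ?X (pigeon_clause n i) \<longleftrightarrow> i = n" if "i \<le> n" for i
    using that unfolding falsifies_pigeon_clause matching_assignment_pvar
    by (metis le_neq_implies_less less_irrefl)
  then have "cost (\<Sum>i\<le>n. {#(pigeon_clause n i, 1)#}) ?X = (\<Sum>i\<le>n. if i = n then 1 else 0)"
    unfolding cost_sum[OF finite_atMost] by (intro sum.cong) auto
  moreover have "cost (\<Sum>j<n. \<Sum>k\<le>n. \<Sum>i<k. {#(hole_clause j k i, 1)#}) ?X = 0"
    unfolding cost_sum[OF finite_atMost] cost_sum[OF finite_lessThan]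
    by (intro sum.neutral ballI) (auto simp: falsifies_hole_clause)
  ultimately have "cost (PHP n) ?X = (\<Sum>i\<le>n. if i = n then 1 else 0)"
    by (simp add: PHP_def)
  then have "cost (PHP n) ?X = 1" by simp
  then show ?thesis unfolding MaxSAT_def
    by (metis Min_le finite_range_cost rangeI)
qed

text \<open>A pigeon clause is falsified only if its own pigeon is omitted. A hole clause is always
  true, as a matching puts one pigeon into each hole.\<close>

lemma card_missed_PHP_le:
  assumes "C \<in> clauses (PHP n)"
  shows "card (missed n D r C) \<le> 1"
proof -
  consider i where "i \<le> n" "C = pigeon_clause n i"
    | j k i where "j < n" "i < k" "C = hole_clause j k i"
    using assms by (auto simp: clauses_def in_PHP_iff)
  then show ?thesis
  proof cases
    case 1
    have "missed n D r C \<subseteq> {i}"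
    proof
      fix i' assume "i' \<in> missed n D r C"
      then obtain h where h: "critical n D r h" "i' \<le> n" "i' \<notin> h ` {..<n}"
        "falsifies (matching_assignment n h) C"
        by (auto simp: missed_def)
      have "i \<notin> h ` {..<n}" using h(4) by (auto simp: 1 falsifies_pigeon_clause)
      then show "i' \<in> {i}" using critical_image[OF h(1-3)] 1 by auto
    qed
    then show ?thesis using card_mono[of "{i}"] by fastforce
  next
    case 2
    then have "missed n D r C = {}" by (auto simp: missed_def falsifies_hole_clause)
    then show ?thesis by simp
  qed
qed

text \<open>The threshold for large clauses is \<open>a * a\<close>, and a matching of
  \<open>3 * a\<close> holes leaves \<open>3 * a\<close> free pigeons. A medium clause misses at
  least \<open>a\<close> and fewer than \<open>2 * a\<close> of these, so it has at least
  \<open>a * a\<close> free edges. With too few clauses the matching would hit all large ones, but a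
  clause with positive measure is not hit.\<close>

lemma ResS_PHP_lower_bound:
  assumes ref: "refutation ResS (PHP n) Fs" and n: "Suc n = 6 * a" and a: "2 \<le> a"
  shows "36 ^ (3 * a) \<le> 35 ^ (3 * a) * card (\<Union>F \<in> set Fs. clauses F)"
proof (rule ccontr)
  let ?\<C> = "\<Union>F \<in> set Fs. clauses F"
  assume small: "\<not> ?thesis"
  have fin: "finite ?\<C>" by simp
  have "Suc n * n \<le> (6 * a) * (6 * a)" using n by (intro mult_le_mono) auto
  then have "n * Suc n \<le> 36 * (a * a)" by (simp add: mult.commute)
  moreover have "3 * a \<le> n" using n a by linarith
  ultimately have "\<exists>D r. D \<subseteq> {..<n} \<and> card D = 3 * a \<and> inj_on r D \<and> r ` D \<subseteq> {..n} \<and>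
    36 ^ (3 * a) * card {C \<in> ?\<C>. (\<forall>j \<in> D. (r j, j) \<notin> edges C) \<and>
      a * a \<le> card (edges C \<inter> free_edges n D r)} \<le> 35 ^ (3 * a) * card ?\<C>"
    by (rule matching_hitting_large_clauses[OF fin])
  then obtain D r where D: "D \<subseteq> {..<n}" "card D = 3 * a"
    and r: "inj_on r D" "r ` D \<subseteq> {..n}"
    and le: "36 ^ (3 * a) * card {C \<in> ?\<C>. (\<forall>j \<in> D. (r j, j) \<notin> edges C) \<and>
      a * a \<le> card (edges C \<inter> free_edges n D r)} \<le> 35 ^ (3 * a) * card ?\<C>" (is "_ * card ?U \<le> _")
    by (elim exE conjE)
  have fD: "finite D" using D finite_subset by blast
  \<comment> \<open>A single surviving large clause would already give the claimed
    inequality.\<close>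
  have U0: "card ?U = 0"
  proof (rule ccontr)
    assume "card ?U \<noteq> 0"
    then have "36 ^ (3 * a) * 1 \<le> 36 ^ (3 * a) * card ?U" by (intro mult_le_mono2) linarith
    with le small show False by linarith
  qed
  have "finite ?U" using fin by (rule rev_finite_subset) blast
  then have U: "?U = {}" using U0 by (rule card_0_eq[THEN iffD1])
  have "card ({..n} - r ` D) = card {..n} - card (r ` D)"
    using r(2) fD by (intro card_Diff_subset finite_imageI)
  also have "\<dots> = Suc n - card D" using r(1) by (simp add: card_image)
  finally have freeP: "card ({..n} - r ` D) = 3 * a" using D(2) n by simp
  obtain F' where pf: "is_proof ResS Fs" "hd Fs = PHP n"
    and F': "regroup (last Fs) F'" "contained (weighted {||} (MaxSAT (PHP n))) F'" "maxsat_formula F'"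
    using ref unfolding refutation_def proof_of_def maxsat_formula_def by (elim conjE exE)
  have "maxsat_formula (last Fs)"
    using ResS_proof_positive[OF pf(1)] maxsat_formula_PHP pf by (simp add: is_proof_def)
  then have "clauses F' = clauses (last Fs)" using regroup_positive F' by blast
  moreover have "weighted {||} (MaxSAT (PHP n)) = {#({||}, MaxSAT (PHP n))#}"
    using MaxSAT_PHP_pos[of n] by (simp add: weighted_def)
  with F'(2) obtain w where "({||}, w) \<in># F'" by (auto simp: contained_def)
  then have "{||} \<in> clauses F'" unfolding clauses_def by (metis fst_conv imageI)
  ultimately have box: "{||} \<in> clauses (last Fs)" by simp
  have final: "a \<le> card (missed n D r {||})"
    unfolding missed_empty_clause[OF D(1) r] freeP by simp
  have init: "card (missed n D r C) < a" if "C \<in> clauses (hd Fs)" for C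
    using card_missed_PHP_le[of C n D r] that a pf(2) by simp
  have "maxsat_formula (hd Fs)" using maxsat_formula_PHP pf(2) by simp
  then obtain F C where C: "F \<in> set Fs" "C \<in> clauses F"
    and card: "a \<le> card (missed n D r C)" "card (missed n D r C) < 2 * a"
    by (rule medium_clause_exists[OF pf(1) _ init box final])
  have "card ({..n} - r ` D - missed n D r C) = card ({..n} - r ` D) - card (missed n D r C)"
    using missed_subset_free[OF D(1)] by (intro card_Diff_subset finite_missed)
  then have "a * a \<le> card (missed n D r C) * card ({..n} - r ` D - missed n D r C)"
    unfolding freeP using card by (intro mult_le_mono) linarith+
  also have "\<dots> \<le> card (edges C \<inter> free_edges n D r)" by (rule card_free_edges_ge[OF D(1)])
  finally have "a * a \<le> card (edges C \<inter> free_edges n D r)" .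
  moreover have "missed n D r C \<noteq> {}" using card a by auto
  then have "\<forall>j \<in> D. (r j, j) \<notin> edges C" using missed_hit[OF _ D(1)] by blast
  ultimately have "C \<in> ?U" using C by (intro CollectI conjI UN_I)
  then show False unfolding U by (rule emptyE)
qed

section \<open>Machines and encodings\<close>

text \<open>The head starts at 0 and moves at most one cell per step, so cells beyond both the input
  and the elapsed time are still blank.\<close>

lemma machine_space:
  fixes M :: program and xs :: "cell list"
  defines "c \<equiv> \<lambda>t. (machine_step M ^^ t) (initial xs)"
  shows "head (c t) \<le> int t \<and>
    (\<forall>p. int (length xs) \<le> p \<and> int t \<le> p \<longrightarrow> tape (c t) p = Sym 0)"
proof (induction t)
  case 0
  then show ?case by (simp add: c_def initial_def tape_of_def)
next
  case (Suc t)
  have "c (Suc t) = machine_step M (c t)" by (simp add: c_def)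
  then show ?case using Suc
    by (cases "M ! pc (c t)") (auto simp: machine_step_def)
qed

text \<open>A nonblank last symbol has to stand on a cell that held input or could be reached in
  time.\<close>

lemma outputs_within_length:
  assumes "outputs_within M xs t ys" "ys \<noteq> []" "last ys \<noteq> Sym 0"
  shows "length ys \<le> length xs + t"
proof (rule ccontr)
  assume "\<not> ?thesis"
  then have "int (length xs) \<le> int (length ys - 1)" "int t \<le> int (length ys - 1)" by linarith+
  then have "tape_of ys (int (length ys - 1)) = Sym 0"
    using machine_space[where M = M and xs = xs and t = t] assms(1) by (simp add: outputs_within_def Let_def)
  then show False using assms(2,3) by (simp add: tape_of_def last_conv_nth split: if_splits)
qed

lemma encode_proof_last: "Fs \<noteq> [] \<Longrightarrow> encode_proof \<mu> Fs \<noteq> [] \<and> last (encode_proof \<mu> Fs) = Sym 7"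
  by (cases Fs rule: rev_cases) (simp_all add: encode_proof_def)

text \<open>Each listed clause contributes at least its separators \<open>Sym 5\<close> and
  \<open>Sym 6\<close>.\<close>

lemma card_clauses_le_encoding:
  "card (clauses (formula_of F)) \<le> length (encode_formula \<mu> F)"
proof -
  have "card (clauses (formula_of F)) \<le> length F"
    using card_image_le[of "set F" "clause_of \<circ> fst"] card_length[of F]
    by (simp add: clauses_def formula_of_def image_image case_prod_beta comp_def)
  also have "length F \<le> length (encode_formula \<mu> F)"
    by (induction F) (auto simp: encode_formula_def)
  finally show ?thesis .
qed

lemma card_proof_clauses_le_encoding:
  "card (\<Union>F \<in> set (map formula_of Fs). clauses F) \<le> length (encode_proof \<mu> Fs)"
proof (induction Fs)
  case (Cons F Fs)
  have "card (\<Union>G \<in> set (map formula_of (F # Fs)). clauses G)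
      \<le> card (clauses (formula_of F)) + card (\<Union>G \<in> set (map formula_of Fs). clauses G)"
    by (simp add: card_Un_le)
  also have "\<dots> \<le> length (encode_formula \<mu> F) + length (encode_proof \<mu> Fs)"
    by (intro add_mono card_clauses_le_encoding Cons.IH)
  also have "\<dots> \<le> length (encode_proof \<mu> (F # Fs))" by (simp add: encode_proof_def)
  finally show ?case .
qed simp

section \<open>Polynomial against exponential growth\<close>

lemma poly_nat_mono:
  fixes q :: "nat poly"
  shows "x \<le> y \<Longrightarrow> poly q x \<le> poly q y"
  by (induction q) (auto intro: mult_le_mono)

text \<open>Write \<open>c ^ a\<close> as a product of two powers of \<open>sqrt c\<close>: one
  absorbs the factor \<open>a\<close>, the other goes to the induction hypothesis, which is stated
  for all bases.\<close>

lemma poly_times_power_tendsto_0: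
  fixes q :: "nat poly" and c :: real
  assumes "0 < c" "c < 1"
  shows "(\<lambda>a. real (poly q a) * c ^ a) \<longlonglongrightarrow> 0"
  using assms
proof (induction q arbitrary: c)
  case (pCons k q)
  have s: "0 < sqrt c" "sqrt c < 1" using pCons.prems by auto
  have eq: "real (poly (pCons k q) a) * c ^ a
      = real k * c ^ a + (real a * sqrt c ^ a) * (real (poly q a) * sqrt c ^ a)" for a
  proof -
    have "c ^ a = sqrt c ^ a * sqrt c ^ a"
      using pCons.prems by (simp flip: power_mult_distrib)
    then show ?thesis by (simp add: algebra_simps)
  qed
  have "(\<lambda>a. real k * c ^ a + (real a * sqrt c ^ a) * (real (poly q a) * sqrt c ^ a))
      \<longlonglongrightarrow> real k * 0 + 0 * 0"
    using pCons.IH[OF s] s pCons.prems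
    by (intro tendsto_add tendsto_mult tendsto_const LIMSEQ_power_zero powser_times_n_limit_0) auto
  then show ?case unfolding eq by simp
qed simp

lemma exponential_exceeds_poly:
  fixes q :: "nat poly"
  shows "\<exists>a\<ge>2. 35 ^ (3 * a) * poly q a < 36 ^ (3 * a)"
proof -
  \<comment> \<open>The exponent \<open>3 * a\<close> comes from the lower bound, hence the cube in
    the base.\<close>
  have "(\<lambda>a. real (poly q a) * ((35 / 36) ^ 3) ^ a) \<longlonglongrightarrow> 0"
    by (rule poly_times_power_tendsto_0) (simp_all add: power_less_one_iff)
  then have "\<forall>\<^sub>F a in sequentially. real (poly q a) * ((35 / 36) ^ 3) ^ a < 1"
    by (rule order_tendstoD) simp
  then obtain N where N: "\<And>a. a \<ge> N \<Longrightarrow> real (poly q a) * ((35 / 36) ^ 3) ^ a < 1"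
    by (auto simp: eventually_sequentially)
  let ?a = "max N 2"
  have "real (poly q ?a) * (35 / 36) ^ (3 * ?a) < 1" using N[of ?a] by (simp only: power_mult max.cobounded1)
  then have "real (35 ^ (3 * ?a) * poly q ?a) < real (36 ^ (3 * ?a))"
    by (simp add: power_divide field_simps)
  then have "35 ^ (3 * ?a) * poly q ?a < 36 ^ (3 * ?a)" by (simp only: of_nat_less_iff)
  then show ?thesis by (intro exI[of _ ?a]) simp
qed

section \<open>Length of written formulas and proofs\<close>

definition literals_below :: "nat \<Rightarrow> literal set" where
  "literals_below V = Pos ` {..<V} \<union> Neg ` {..<V}"

text \<open>Unit weights have codes of constant length in both machine models, so only variables and
  numbers of clauses affect the length.\<close>

definition bounded_formula :: "nat \<Rightarrow> formula \<Rightarrow> bool" where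
  "bounded_formula V F \<longleftrightarrow> (\<forall>(C, w) \<in># F. fset C \<subseteq> literals_below V \<and> (w = 1 \<or> w = - 1))"

lemma bounded_formula_simps [simp]:
  "bounded_formula V {#}"
  "bounded_formula V (add_mset (C, w) F) \<longleftrightarrow>
     fset C \<subseteq> literals_below V \<and> (w = 1 \<or> w = - 1) \<and> bounded_formula V F"
  "bounded_formula V (F + G) \<longleftrightarrow> bounded_formula V F \<and> bounded_formula V G"
  by (auto simp: bounded_formula_def)

lemma length_encode_nat: "length (encode_nat n) \<le> n"
proof (induction n rule: less_induct)
  case (less n)
  show ?case
  proof (cases "n = 0")
    case False
    then have "length (encode_nat (n div 2)) \<le> n div 2" by (intro less) simp
    then show ?thesis using False by (subst encode_nat.simps) simp
  qed (simp add: encode_nat.simps)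
qed

text \<open>The longest code is that of -1 as a rational: sign, numerator, separator and
  denominator.\<close>

lemma length_encode_unit_weight:
  assumes "w = 1 \<or> w = - 1"
  shows "length (encode_weight \<mu> w) \<le> 4" "w \<in> weights \<mu>"
proof -
  have one: "inv real_of_rat 1 = 1" "inv real_of_rat (- 1) = - 1"
    using inv_f_f[of real_of_rat 1] inv_f_f[of real_of_rat "- 1"] by (simp_all add: inj_def)
  have [simp]: "encode_nat (Suc 0) = [Sym 2]" by (simp add: encode_nat.simps)
  have w: "w = ereal 1 \<or> w = ereal (- 1)" using assms by (auto simp: one_ereal_def)
  then show "length (encode_weight \<mu> w) \<le> 4"
    by (cases \<mu>) (auto simp: encode_weight_def encode_rat_def one)
  show "w \<in> weights \<mu>" using w by (cases \<mu>) auto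
qed

text \<open>A listing without repetitions has at most \<open>2 * V\<close> literals, each of at most
  \<open>V + 1\<close> symbols.\<close>

lemma written_clause_exists:
  assumes "fset C \<subseteq> literals_below V"
  shows "\<exists>ls. clause_of ls = C \<and> length (concat (map encode_literal ls)) \<le> 2 * V * (V + 1)"
proof -
  obtain ls where ls: "set ls = fset C" "distinct ls"
    using finite_distinct_list[of "fset C"] by auto
  have "length ls = card (fset C)" using ls distinct_card by metis
  also have "\<dots> \<le> card (literals_below V)"
    by (intro card_mono assms) (simp add: literals_below_def)
  also have "\<dots> \<le> card (Pos ` {..<V}) + card (Neg ` {..<V})"
    unfolding literals_below_def by (rule card_Un_le)
  also have "\<dots> \<le> V + V" by (intro add_mono) (metis card_image_le card_lessThan finite_lessThan)+
  finally have len: "length ls \<le> 2 * V" by simp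
  have "length (encode_literal l) \<le> V + 1" if "l \<in> set ls" for l
  proof -
    have "l \<in> literals_below V" using that ls(1) assms by blast
    then obtain x where "x < V" "l = Pos x \<or> l = Neg x" by (auto simp: literals_below_def)
    then show ?thesis using length_encode_nat[of x] by auto
  qed
  then have "length (concat (map encode_literal ls)) \<le> length ls * (V + 1)"
  proof (induction ls)
    case (Cons l ls)
    then have "length (encode_literal l) \<le> V + 1"
      "length (concat (map encode_literal ls)) \<le> length ls * (V + 1)" by simp_all
    then show ?case by (simp del: length_concat)
  qed simp
  also have "\<dots> \<le> 2 * V * (V + 1)" by (intro mult_le_mono1 len)
  finally have "length (concat (map encode_literal ls)) \<le> 2 * V * (V + 1)" .
  moreover have "clause_of ls = C" using ls(1) by (simp add: fset_of_list.rep_eq flip: fset_inject)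
  ultimately show ?thesis by blast
qed

text \<open>Besides its literals, each clause costs at most 4 symbols for the weight and 2
  separators.\<close>

lemma written_formula_exists:
  assumes "bounded_formula V F"
  shows "\<exists>W. formula_of W = F \<and> (\<forall>(C, w) \<in> set W. w \<in> weights \<mu>) \<and>
    length (encode_formula \<mu> W) \<le> size F * (2 * V * (V + 1) + 6)"
  using assms
proof (induction F)
  case empty
  then show ?case by (intro exI[of _ "[]"]) (simp add: formula_of_def encode_formula_def)
next
  case (add Cw F)
  obtain C w where Cw: "Cw = (C, w)" by force
  obtain W where W: "formula_of W = F" "\<forall>(C, w) \<in> set W. w \<in> weights \<mu>"
    "length (encode_formula \<mu> W) \<le> size F * (2 * V * (V + 1) + 6)"
    using add by (auto simp: Cw)
  obtain ls where ls: "clause_of ls = C" "length (concat (map encode_literal ls)) \<le> 2 * V * (V + 1)"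
    using written_clause_exists[of C V] add.prems unfolding Cw bounded_formula_simps by blast
  have w: "length (encode_weight \<mu> w) \<le> 4" "w \<in> weights \<mu>"
    using length_encode_unit_weight add.prems by (auto simp: Cw)
  have "encode_formula \<mu> ((ls, w) # W) = concat (map encode_literal ls) @ [Sym 5] @
      encode_weight \<mu> w @ [Sym 6] @ encode_formula \<mu> W"
    by (simp add: encode_formula_def)
  then have "length (encode_formula \<mu> ((ls, w) # W)) \<le> size (add_mset Cw F) * (2 * V * (V + 1) + 6)"
    using ls(2) w(1) W(3) by (simp del: length_concat)
  moreover have "formula_of ((ls, w) # W) = add_mset Cw F"
    using W(1) ls(1) by (simp add: formula_of_def Cw)
  ultimately show ?case using W(2) w(2) by (intro exI[of _ "(ls, w) # W"]) auto
qed

lemma written_proof_exists: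
  assumes "\<And>F. F \<in> set Fs \<Longrightarrow> bounded_formula V F \<and> size F \<le> s"
  shows "\<exists>Ws. map formula_of Ws = Fs \<and> (\<forall>W \<in> set Ws. \<forall>(C, w) \<in> set W. w \<in> weights \<mu>) \<and>
    length (encode_proof \<mu> Ws) \<le> length Fs * (s * (2 * V * (V + 1) + 6) + 1)"
  using assms
proof (induction Fs)
  case Nil
  then show ?case by (simp add: encode_proof_def)
next
  case (Cons F Fs)
  have "\<And>F. F \<in> set Fs \<Longrightarrow> bounded_formula V F \<and> size F \<le> s" using Cons.prems by simp
  then obtain Ws where Ws: "map formula_of Ws = Fs" "\<forall>W \<in> set Ws. \<forall>(C, w) \<in> set W. w \<in> weights \<mu>"
    "length (encode_proof \<mu> Ws) \<le> length Fs * (s * (2 * V * (V + 1) + 6) + 1)"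
    using Cons.IH by blast
  obtain W where W: "formula_of W = F" "\<forall>(C, w) \<in> set W. w \<in> weights \<mu>"
    "length (encode_formula \<mu> W) \<le> size F * (2 * V * (V + 1) + 6)"
    using written_formula_exists Cons.prems by (metis list.set_intros(1))
  note W(3)
  also have "size F * (2 * V * (V + 1) + 6) \<le> s * (2 * V * (V + 1) + 6)"
    using Cons.prems by (intro mult_le_mono1) simp
  finally have "length (encode_proof \<mu> (W # Ws)) \<le> length (F # Fs) * (s * (2 * V * (V + 1) + 6) + 1)"
    using Ws(3) by (simp add: encode_proof_def)
  then show ?case using W(1,2) Ws(1,2) by (intro exI[of _ "W # Ws"]) auto
qed

section \<open>Short refutations with the virtual rule\<close>

text \<open>Derivations apply rules without regrouping, which is postponed to the end of the
  refutation. The one parameter \<open>V\<close> bounds both the variables and the number of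
  consequents of each inference.\<close>

inductive bounded_derivation :: "nat \<Rightarrow> nat \<Rightarrow> formula \<Rightarrow> formula \<Rightarrow> bool" for V where
  refl: "bounded_derivation V 0 F F"
| step: "\<lbrakk>bounded_derivation V k F (P + H); R \<in> ResSV; R P Q; bounded_formula V Q; size Q \<le> V\<rbrakk>
    \<Longrightarrow> bounded_derivation V (Suc k) F (Q + H)"

lemma bounded_derivation_frame:
  "bounded_derivation V k F G \<Longrightarrow> bounded_derivation V k (F + H) (G + H)"
proof (induction rule: bounded_derivation.induct)
  case (step k F P H' R Q)
  then show ?case using bounded_derivation.step[of V k "F + H" P "H' + H" R Q] by (simp add: add.assoc)
qed (rule bounded_derivation.refl)

lemma bounded_derivation_trans:
  "bounded_derivation V l G H \<Longrightarrow> bounded_derivation V k F G \<Longrightarrow> bounded_derivation V (k + l) F H"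
  by (induction rule: bounded_derivation.induct) (auto intro: bounded_derivation.step)

lemma bounded_derivation_proof:
  assumes "bounded_derivation V k F G" "bounded_formula V F"
  shows "\<exists>Fs. length Fs = Suc k \<and> is_proof ResSV Fs \<and> hd Fs = F \<and> last Fs = G \<and>
    (\<forall>H \<in> set Fs. bounded_formula V H \<and> size H \<le> size F + k * V)"
  using assms
proof (induction rule: bounded_derivation.induct)
  case (refl F)
  then show ?case by (intro exI[of _ "[F]"]) (simp add: is_proof_def)
next
  case (step k F P H R Q)
  then obtain Fs where Fs: "length Fs = Suc k" "is_proof ResSV Fs" "hd Fs = F" "last Fs = P + H"
    "\<forall>H \<in> set Fs. bounded_formula V H \<and> size H \<le> size F + k * V"
    by auto
  have "proof_step ResSV (P + H) (Q + H)"
    unfolding proof_step_def using step.hyps(2,3) by blast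
  moreover have "P + H = Fs ! k" using Fs by (metis diff_Suc_1 last_conv_nth list.size(3) nat.distinct(1))
  ultimately have "is_proof ResSV (Fs @ [Q + H])"
    using Fs(1,2) by (auto simp: is_proof_def nth_append less_Suc_eq)
  moreover have "P + H \<in> set Fs" using Fs by (metis last_in_set list.size(3) nat.distinct(1))
  then have "bounded_formula V (P + H)" "size (P + H) \<le> size F + k * V" using Fs(5) by blast+
  then have "bounded_formula V (Q + H)" "size (Q + H) \<le> size F + Suc k * V"
    using step.hyps(4,5) by simp_all
  moreover have "\<forall>H \<in> set Fs. bounded_formula V H \<and> size H \<le> size F + Suc k * V"
    using Fs(5) by (auto simp: trans_le_add2)
  moreover have "Fs \<noteq> []" using Fs(1) by auto
  ultimately show ?case using Fs by (intro exI[of _ "Fs @ [Q + H]"]) simp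
qed

text \<open>By-products \<open>Z\<close> may be ignored as long as their weights are positive, because the last
  formula of a refutation must not contain negative weights.\<close>

definition derives :: "nat \<Rightarrow> nat \<Rightarrow> formula \<Rightarrow> formula \<Rightarrow> bool" where
  "derives V k F G \<longleftrightarrow> (\<exists>Z l. l \<le> k \<and> maxsat_formula Z \<and> bounded_derivation V l F (G + Z))"

lemma derives_refl: "derives V k F F"
  unfolding derives_def
  by (intro exI[of _ "{#}"] exI[of _ 0]) (simp add: bounded_derivation.refl)

lemma derives_mono: "derives V k F G \<Longrightarrow> k \<le> l \<Longrightarrow> derives V l F G"
  unfolding derives_def using order_trans by blast

lemma derives_rule:
  assumes "R \<in> ResSV" "R P (G + Z)" "maxsat_formula Z" "bounded_formula V (G + Z)" "size (G + Z) \<le> V"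
  shows "derives V 1 P G"
proof -
  have "bounded_derivation V (Suc 0) P (G + Z + {#})"
    using assms bounded_derivation.step[of V 0 P P "{#}" R "G + Z"]
    by (simp add: bounded_derivation.refl)
  then show ?thesis unfolding derives_def using assms(3) by (intro exI[of _ Z] exI[of _ 1]) simp
qed

lemma derives_frame: "derives V k F G \<Longrightarrow> derives V k (F + H) (G + H)"
proof -
  assume "derives V k F G"
  then obtain Z l where "l \<le> k" "maxsat_formula Z" "bounded_derivation V l F (G + Z)"
    by (auto simp: derives_def)
  then show ?thesis using bounded_derivation_frame[of V l F "G + Z" H] unfolding derives_def
    by (intro exI[of _ Z] exI[of _ l]) (simp add: add_ac)
qed

lemma derives_trans:
  assumes "derives V k F G" "derives V l G H"
  shows "derives V (k + l) F H"
proof -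
  obtain Z k' where k: "k' \<le> k" "maxsat_formula Z" "bounded_derivation V k' F (G + Z)"
    using assms(1) by (auto simp: derives_def)
  obtain Y l' where l: "l' \<le> l" "maxsat_formula Y" "bounded_derivation V l' G (H + Y)"
    using assms(2) by (auto simp: derives_def)
  have "bounded_derivation V (k' + l') F (H + Y + Z)"
    using bounded_derivation_trans[OF bounded_derivation_frame[OF l(3)] k(3)] .
  then show ?thesis unfolding derives_def using k l
    by (intro exI[of _ "Y + Z"] exI[of _ "k' + l'"]) (simp add: add_ac)
qed

lemma derives_add:
  assumes "derives V k F G" "derives V l F' G'"
  shows "derives V (k + l) (F + F') (G + G')"
proof (rule derives_trans)
  show "derives V k (F + F') (G + F')" using assms(1) by (rule derives_frame)
  show "derives V l (G + F') (G + G')"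
    using derives_frame[OF assms(2), of G] by (simp add: add.commute)
qed

lemma derives_sum:
  assumes "finite I" "\<And>i. i \<in> I \<Longrightarrow> derives V k (F i) (G i)"
  shows "derives V (card I * k) (sum F I) (sum G I)"
  using assms
proof (induction I rule: finite_induct)
  case (insert i I)
  then show ?case using derives_add[of V k "F i" "G i" "card I * k" "sum F I" "sum G I"] by simp
qed (simp add: derives_refl)

lemma size_or_not: "size (or_not E D u) \<le> length D"
  by (induction E D u rule: or_not.induct) (auto simp: weighted_def)

lemma negate_in_literals_below: "l \<in> literals_below V \<Longrightarrow> negate l \<in> literals_below V"
  by (auto simp: literals_below_def)

lemma bounded_or_not:
  "set E \<subseteq> literals_below V \<Longrightarrow> set D \<subseteq> literals_below V \<Longrightarrow> bounded_formula V (or_not E D 1)"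
proof (induction D arbitrary: E)
  case (Cons l D)
  then have "bounded_formula V (or_not (E @ [l]) D 1)" by simp
  then show ?case using Cons.prems
    by (simp add: weighted_def fset_of_list.rep_eq negate_in_literals_below)
qed simp

text \<open>With weights 1 both premises are used up. The resolvent survives because it is no
  tautology, and the remaining by-products have weight 1, so they may be ignored.\<close>

lemma derives_resolution:
  assumes "distinct A" "Pos x \<notin> set A" "distinct B" "Neg x \<notin> set B"
    and "\<not> tautology (clause_of (A @ B))"
    and lits: "set A \<subseteq> literals_below V" "set B \<subseteq> literals_below V" "x < V"
    and len: "length A + length B < V"
    and eq: "C1 = clause_of (Pos x # A)" "C2 = clause_of (Neg x # B)" "C3 = clause_of (A @ B)"
  shows "derives V 1 ({#(C1, 1)#} + {#(C2, 1)#}) {#(C3, 1)#}"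
proof -
  define Y where "Y = or_not (Pos x # A) B 1 + or_not (Neg x # B) A 1"
  define Z where "Z = discard_tautologies Y"
  have x: "Pos x \<in> literals_below V" "Neg x \<in> literals_below V"
    using lits(3) by (auto simp: literals_below_def)
  have Y: "bounded_formula V Y" unfolding Y_def using lits x by (simp add: bounded_or_not)
  have "set_mset Z \<subseteq> set_mset Y" by (auto simp: Z_def discard_tautologies_def)
  then have Z: "bounded_formula V Z" using Y unfolding bounded_formula_def by blast
  have pos: "maxsat_formula Z"
    by (auto simp: Z_def Y_def maxsat_formula_def discard_tautologies_def dest: in_or_not)
  have "size Z \<le> size Y" unfolding Z_def discard_tautologies_def by (rule size_filter_mset_lesseq)
  also have "size Y \<le> length B + length A"
    unfolding Y_def by (simp add: add_mono size_or_not)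
  finally have size: "size ({#(C3, 1)#} + Z) \<le> V" using len by simp
  have "resolution {#(clause_of (Pos x # A), 1), (clause_of (Neg x # B), 1)#}
     (discard_tautologies
       (weighted (clause_of (A @ B)) 1
        + weighted (clause_of (Pos x # A)) (1 - 1)
        + weighted (clause_of (Neg x # B)) (1 - 1)
        + or_not (Pos x # A) B 1
        + or_not (Neg x # B) A 1))"
    using assms by (intro resolution.intros) simp_all
  moreover have "(1 :: ereal) - 1 = 0" by (simp add: one_ereal_def)
  ultimately have "resolution ({#(C1, 1)#} + {#(C2, 1)#}) ({#(C3, 1)#} + Z)"
    using assms(5) by (simp add: eq Z_def Y_def weighted_def discard_tautologies_def add_mset_commute)
  moreover have "fset C3 \<subseteq> literals_below V" using lits by (simp add: eq fset_of_list.rep_eq)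
  ultimately show ?thesis
    using Z pos size by (intro derives_rule[of resolution]) (simp_all add: ResSV_def)
qed

lemma derives_split:
  assumes "fset C \<subseteq> literals_below V" "x < V" "2 \<le> V"
  shows "derives V 1 {#(C, 1)#} ({#(finsert (Pos x) C, 1)#} + {#(finsert (Neg x) C, 1)#})"
proof (rule derives_rule[where R = split and Z = "{#}"])
  show "split {#(C, 1)#} ({#(finsert (Pos x) C, 1)#} + {#(finsert (Neg x) C, 1)#} + {#})"
    using split.intros[of 1 C x] by (simp add: add_mset_commute)
qed (use assms in \<open>auto simp: ResSV_def literals_below_def\<close>)

lemma derives_virtual:
  assumes "fset C \<subseteq> literals_below V" "2 \<le> V"
  shows "derives V 1 {#} ({#(C, 1)#} + {#(C, - 1)#})"
proof (rule derives_rule[where R = virtual and Z = "{#}"])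
  have "virtual {#} (weighted C 1 + weighted C (- 1))" by (rule virtual.intros) simp
  then show "virtual {#} ({#(C, 1)#} + {#(C, - 1)#} + {#})" by (simp add: weighted_def)
qed (use assms in \<open>simp_all add: ResSV_def\<close>)

section \<open>Derivations from the pigeonhole clauses\<close>

lemma derives_pigeon:
  assumes "m < V" "\<And>j. j < m \<Longrightarrow> pvar i j < V"
  shows "derives V m ({#(pigeon_clause m i, 1)#} + (\<Sum>j<m. {#({|Neg (pvar i j)|}, 1)#})) {#({||}, 1)#}"
  using assms
proof (induction m)
  case 0
  then show ?case by (simp add: pigeon_clause_def derives_refl)
next
  case (Suc m)
  let ?S = "\<Sum>j<m. {#({|Neg (pvar i j)|}, 1 :: ereal)#}"
  \<comment> \<open>The literal of the last hole is resolved away with a unit clause; repeating this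
    ends in the empty clause.\<close>
  have "derives V 1 ({#(pigeon_clause (Suc m) i, 1)#} + {#({|Neg (pvar i m)|}, 1)#}) {#(pigeon_clause m i, 1)#}"
    using Suc.prems
    by (intro derives_resolution[where x = "pvar i m" and A = "map (\<lambda>j. Pos (pvar i j)) [0..<m]" and B = "[]"])
      (auto simp: pigeon_clause_def distinct_map inj_on_def literals_below_def tautology_def fset_of_list.rep_eq
        simp flip: fset_inject)
  from derives_frame[OF this, of ?S]
  have "derives V 1 ({#(pigeon_clause (Suc m) i, 1)#} + (\<Sum>j<Suc m. {#({|Neg (pvar i j)|}, 1)#}))
      ({#(pigeon_clause m i, 1)#} + ?S)"
    by (simp add: add_ac)
  moreover have "derives V m ({#(pigeon_clause m i, 1)#} + ?S) {#({||}, 1)#}"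
    using Suc by simp
  ultimately have "derives V (1 + m) ({#(pigeon_clause (Suc m) i, 1)#} + (\<Sum>j<Suc m. {#({|Neg (pvar i j)|}, 1)#}))
      {#({||}, 1)#}"
    by (rule derives_trans)
  then show ?case by simp
qed

text \<open>One of the first \<open>k\<close> pigeons sits in hole \<open>j\<close>. These clauses
  arise from the empty clause by splitting on the variables of the hole in turn, always continuing
  with the positive side.\<close>

definition column_clause :: "nat \<Rightarrow> nat \<Rightarrow> clause" where
  "column_clause j k = clause_of (map (\<lambda>i. Pos (pvar i j)) [0..<k])"

text \<open>Resolving with the hole clause of pigeons \<open>k\<close> and \<open>m\<close> removes
  the positive literal of \<open>k\<close>. Its other literal is already present, so the clause
  shrinks to the unit.\<close>

lemma derives_hole_unit:
  assumes "k \<le> m" "Suc m < V" "\<And>i. i \<le> m \<Longrightarrow> pvar i j < V"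
  shows "derives V k ({#(finsert (Neg (pvar m j)) (column_clause j k), 1)#} +
      (\<Sum>i<k. {#(hole_clause j m i, 1)#})) {#({|Neg (pvar m j)|}, 1)#}"
  using assms(1)
proof (induction k)
  case 0
  then show ?case by (simp add: column_clause_def derives_refl)
next
  case (Suc k)
  let ?S = "\<Sum>i<k. {#(hole_clause j m i, 1 :: ereal)#}"
  let ?A = "Neg (pvar m j) # map (\<lambda>i. Pos (pvar i j)) [0..<k]"
  have "derives V 1 ({#(finsert (Neg (pvar m j)) (column_clause j (Suc k)), 1)#} +
      {#(hole_clause j m k, 1)#}) {#(finsert (Neg (pvar m j)) (column_clause j k), 1)#}"
    using Suc.prems assms(2,3)
    by (intro derives_resolution[where x = "pvar k j" and A = ?A and B = "[Neg (pvar m j)]"])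
      (auto simp: column_clause_def hole_clause_def distinct_map inj_on_def literals_below_def
        tautology_def fset_of_list.rep_eq simp flip: fset_inject)
  from derives_frame[OF this, of ?S]
  have "derives V 1 ({#(finsert (Neg (pvar m j)) (column_clause j (Suc k)), 1)#} +
      (\<Sum>i<Suc k. {#(hole_clause j m i, 1)#}))
      ({#(finsert (Neg (pvar m j)) (column_clause j k), 1)#} + ?S)"
    by (simp add: add_ac add_mset_commute)
  moreover have "derives V k ({#(finsert (Neg (pvar m j)) (column_clause j k), 1)#} + ?S)
      {#({|Neg (pvar m j)|}, 1)#}"
    using Suc by simp
  ultimately have "derives V (1 + k) ({#(finsert (Neg (pvar m j)) (column_clause j (Suc k)), 1)#} +
      (\<Sum>i<Suc k. {#(hole_clause j m i, 1)#})) {#({|Neg (pvar m j)|}, 1)#}"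
    by (rule derives_trans)
  then show ?case by simp
qed

text \<open>Split the current column clause on the variable of the next pigeon. The positive side is
  the next column clause, and the hole clauses reduce the negative side to a unit. So one empty
  clause pays for the units of all pigeons.\<close>

lemma derives_hole:
  assumes "m \<le> K" "K < V" "\<And>i. i < m \<Longrightarrow> pvar i j < V"
  shows "derives V (m * K) ({#({||}, 1)#} + (\<Sum>k<m. \<Sum>i<k. {#(hole_clause j k i, 1)#}))
    ({#(column_clause j m, 1)#} + (\<Sum>k<m. {#({|Neg (pvar k j)|}, 1)#}))"
  using assms(1,3)
proof (induction m)
  case 0
  then show ?case by (simp add: column_clause_def derives_refl)
next
  case (Suc m)
  let ?H = "\<lambda>m. \<Sum>k<m. \<Sum>i<k. {#(hole_clause j k i, 1 :: ereal)#}"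
  let ?U = "\<lambda>m. \<Sum>k<m. {#({|Neg (pvar k j)|}, 1 :: ereal)#}"
  let ?S = "\<Sum>i<m. {#(hole_clause j m i, 1 :: ereal)#}"
  let ?E = "\<lambda>m. {#(column_clause j m, 1 :: ereal)#}"
  let ?D = "{#(finsert (Neg (pvar m j)) (column_clause j m), 1 :: ereal)#}"
  have col: "column_clause j (Suc m) = finsert (Pos (pvar m j)) (column_clause j m)"
    by (auto simp: column_clause_def fset_of_list.rep_eq simp flip: fset_inject)
  have "derives V 1 (?E m) (?E (Suc m) + ?D)"
    unfolding col using Suc.prems assms(2)
    by (intro derives_split) (auto simp: column_clause_def fset_of_list.rep_eq literals_below_def)
  from derives_frame[OF this, of ?S] have "derives V 1 (?E m + ?S) (?E (Suc m) + (?D + ?S))"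
    by (simp add: add.assoc)
  moreover have "derives V m (?D + ?S) {#({|Neg (pvar m j)|}, 1)#}"
    using Suc.prems assms(2) by (intro derives_hole_unit) auto
  from derives_frame[OF this, of "?E (Suc m)"]
  have "derives V m (?E (Suc m) + (?D + ?S)) (?E (Suc m) + {#({|Neg (pvar m j)|}, 1)#})"
    by (simp only: add.commute)
  ultimately have "derives V (1 + m) (?E m + ?S) (?E (Suc m) + {#({|Neg (pvar m j)|}, 1)#})"
    by (rule derives_trans)
  from derives_frame[OF this, of "?U m"]
  have "derives V (1 + m) (?E m + ?U m + ?S) (?E (Suc m) + ?U (Suc m))"
    by (simp add: add_ac)
  moreover have "derives V (m * K) ({#({||}, 1)#} + ?H m) (?E m + ?U m)"
    using Suc by simp
  from derives_frame[OF this, of ?S]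
  have "derives V (m * K) ({#({||}, 1)#} + ?H (Suc m)) (?E m + ?U m + ?S)"
    by (simp add: add.assoc)
  ultimately have "derives V (m * K + (1 + m)) ({#({||}, 1)#} + ?H (Suc m)) (?E (Suc m) + ?U (Suc m))"
    by (rule derives_trans[rotated])
  then show ?case by (rule derives_mono) (use Suc.prems in simp)
qed

lemma derives_drop: "derives V k F ({#(C, 1)#} + G) \<Longrightarrow> derives V k F G"
proof -
  assume "derives V k F ({#(C, 1)#} + G)"
  then obtain Z l where "l \<le> k" "maxsat_formula Z" "bounded_derivation V l F ({#(C, 1)#} + G + Z)"
    by (auto simp: derives_def)
  then show ?thesis unfolding derives_def
    by (intro exI[of _ "add_mset (C, 1) Z"] exI[of _ l]) simp
qed

lemma derives_PHP:
  assumes V: "Suc n < V" "\<And>i j. i \<le> n \<Longrightarrow> j < n \<Longrightarrow> pvar i j < V"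
  shows "derives V (3 * Suc n ^ 3) (PHP n) ({#({||}, 1)#} +
    (\<Sum>i\<le>n. \<Sum>j<n. {#({|Neg (pvar i j)|}, 1)#} + {#({|Neg (pvar i j)|}, - 1)#}))"
proof -
  let ?P = "\<Sum>i\<le>n. {#(pigeon_clause n i, 1 :: ereal)#}"
  let ?H = "\<lambda>j. \<Sum>k\<le>n. \<Sum>i<k. {#(hole_clause j k i, 1 :: ereal)#}"
  let ?U = "\<lambda>i j. {#({|Neg (pvar i j)|}, 1 :: ereal)#}"
  let ?N = "\<lambda>i j. {#({|Neg (pvar i j)|}, - 1 :: ereal)#}"
  let ?B = "{#({||}, 1 :: ereal)#}"
  define HH UU NN where "HH = (\<Sum>j<n. ?H j)" and "UU = (\<Sum>i\<le>n. \<Sum>j<n. ?U i j)"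
    and "NN = (\<Sum>i\<le>n. \<Sum>j<n. ?N i j)"
  have UN: "(\<Sum>i\<le>n. \<Sum>j<n. ?U i j + ?N i j) = UU + NN"
    by (simp only: UU_def NN_def sum.distrib)
  have PHP: "PHP n = ?P + HH" by (simp add: PHP_def HH_def)
  have "derives V (card {..n} * (card {..<n} * 1)) (\<Sum>i\<le>n. \<Sum>j<n. {#}) (\<Sum>i\<le>n. \<Sum>j<n. ?U i j + ?N i j)"
    using V by (intro derives_sum derives_virtual) (auto simp: literals_below_def)
  then have "derives V (Suc n * n) {#} (UU + NN)" unfolding UN by simp
  from derives_frame[OF this, of "PHP n"]
  have 1: "derives V (Suc n * n) (PHP n) ((?P + UU) + (HH + NN))"
    by (simp add: PHP add_ac)
  \<comment> \<open>All positive units \<open>UU\<close> are spent here, and each of the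
    \<open>n + 1\<close> pigeons yields an empty clause.\<close>
  have "derives V (card {..n} * n) (\<Sum>i\<le>n. {#(pigeon_clause n i, 1)#} + (\<Sum>j<n. ?U i j)) (\<Sum>i\<le>n. ?B)"
    using V by (intro derives_sum derives_pigeon) auto
  then have "derives V (Suc n * n) (?P + UU) (\<Sum>i\<le>n. ?B)"
    unfolding sum.distrib UU_def by simp
  from derives_frame[OF this, of "HH + NN"]
  have 2: "derives V (Suc n * n) ((?P + UU) + (HH + NN)) ((\<Sum>i\<le>n. ?B) + (HH + NN))" .
  have "derives V (Suc n * Suc n) (?B + ?H j) (\<Sum>k\<le>n. ?U k j)" if "j < n" for j
  \<comment> \<open>The column clause left after the last split is a positive by-product.\<close>
  proof (rule derives_drop)
    show "derives V (Suc n * Suc n) (?B + ?H j)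
        ({#(column_clause j (Suc n), 1)#} + (\<Sum>k\<le>n. ?U k j))"
      unfolding lessThan_Suc_atMost[symmetric]
      by (rule derives_hole) (use V that in \<open>auto simp: less_Suc_eq_le\<close>)
  qed
  then have "derives V (card {..<n} * (Suc n * Suc n)) (\<Sum>j<n. ?B + ?H j) (\<Sum>j<n. \<Sum>k\<le>n. ?U k j)"
    by (intro derives_sum) auto
  \<comment> \<open>The units were consumed pigeon by pigeon and are recovered hole by hole.\<close>
  moreover have "(\<Sum>j<n. \<Sum>k\<le>n. ?U k j) = UU" unfolding UU_def by (rule sum.swap)
  ultimately have "derives V (n * (Suc n * Suc n)) ((\<Sum>j<n. ?B) + HH) UU"
    unfolding HH_def sum.distrib by simp
  from derives_frame[OF this, of "?B + NN"]
  have "derives V (n * (Suc n * Suc n)) ((\<Sum>j<n. ?B) + HH + (?B + NN)) (UU + (?B + NN))" .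
  \<comment> \<open>One of the \<open>n + 1\<close> empty clauses is set aside; the other
    \<open>n\<close> pay for one hole each.\<close>
  moreover have "(\<Sum>j<n. ?B) + HH + (?B + NN) = (\<Sum>i\<le>n. ?B) + (HH + NN)"
    unfolding lessThan_Suc_atMost[symmetric] by (simp only: sum.lessThan_Suc add_ac)
  moreover have "UU + (?B + NN) = ?B + (UU + NN)" by (simp only: add_ac)
  ultimately have 3: "derives V (n * (Suc n * Suc n)) ((\<Sum>i\<le>n. ?B) + (HH + NN)) (?B + (UU + NN))"
    by (simp only:)
  have "derives V (Suc n * n + (Suc n * n + n * (Suc n * Suc n))) (PHP n) (?B + (UU + NN))"
    by (intro derives_trans[OF 1] derives_trans[OF 2] 3)
  moreover have "Suc n * n + (Suc n * n + n * (Suc n * Suc n)) \<le> 3 * Suc n ^ 3"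
    by (simp add: power3_eq_cube algebra_simps)
  ultimately show ?thesis unfolding UN by (rule derives_mono)
qed

text \<open>Merging a pair gives weight 0, so the pair disappears.\<close>

lemma regroup_cancel:
  assumes "finite I"
  shows "regroup (Y + (\<Sum>i\<in>I. {#(C i, 1)#} + {#(C i, - 1)#})) Y"
  using assms
proof (induction I rule: finite_induct)
  case (insert i I)
  let ?S = "\<Sum>i\<in>I. {#(C i, 1 :: ereal)#} + {#(C i, - 1)#}"
  have "regroup1 (Y + ?S + {#(C i, 1), (C i, - 1)#}) (Y + ?S + weighted (C i) (1 + - 1))"
    by (rule regroup1.merge)
  moreover have "(1 :: ereal) + - 1 = 0" by (simp add: one_ereal_def)
  ultimately have "regroup1 (Y + (\<Sum>i\<in>insert i I. {#(C i, 1)#} + {#(C i, - 1)#})) (Y + ?S)"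
    using insert.hyps by (simp add: weighted_def add_ac add_mset_commute)
  then show ?case using insert.IH by (rule converse_rtranclp_into_rtranclp)
qed simp

section \<open>Size of the refutation\<close>

lemma pvar_less: "i \<le> n \<Longrightarrow> j < n \<Longrightarrow> pvar i j < (2 * Suc n + 1)\<^sup>2"
proof -
  assume "i \<le> n" "j < n"
  then have "triangle (i + j) \<le> 2 * n * (2 * n + 1)"
    unfolding triangle_def by (intro div_le_dividend[THEN order_trans] mult_le_mono) auto
  then have "pvar i j \<le> 2 * n * (2 * n + 1) + n"
    using \<open>i \<le> n\<close> by (simp add: pvar_def prod_encode_def)
  also have "\<dots> < (2 * Suc n + 1)\<^sup>2" by (simp add: power2_eq_square algebra_simps)
  finally show ?thesis .
qed

lemma size_PHP: "size (PHP n) \<le> Suc n + Suc n ^ 3"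
proof -
  have "size (PHP n) = Suc n + n * (\<Sum>k\<le>n. k)" by (simp add: PHP_def size_multiset_sum)
  also have "(\<Sum>k\<le>n. k) \<le> (\<Sum>k\<le>n. Suc n)" by (intro sum_mono) auto
  also have "n * (\<Sum>k\<le>n. Suc n) \<le> Suc n * (Suc n * Suc n)" by (intro mult_le_mono) auto
  finally show ?thesis by (simp add: power3_eq_cube algebra_simps)
qed

text \<open>Stated over an arbitrary semiring so that it can be evaluated both at a number and at a
  polynomial. The factors bound the number of formulas and the length of each, \<open>V\<close>
  being the bound on the variables.\<close>

definition encoding_bound :: "'a \<Rightarrow> 'a :: comm_semiring_1" where
  "encoding_bound K = (let V = (2 * K + 1)\<^sup>2 in
     (3 * K ^ 3 + 1) * ((K + K ^ 3 + 3 * K ^ 3 * V) * (2 * V * (V + 1) + 6) + 1))"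

lemma ResSV_PHP_upper_bound:
  "\<exists>Ws. written_refutation \<mu> ResSV (PHP n) Ws \<and>
    length (encode_proof \<mu> Ws) \<le> encoding_bound (Suc n)"
proof -
  define K V where "K = Suc n" and "V = (2 * K + 1)\<^sup>2"
  have V: "pvar i j < V" if "i \<le> n" "j < n" for i j
    using pvar_less[OF that] by (simp add: V_def K_def)
  have KV: "Suc n < V" by (simp add: V_def K_def power2_eq_square)
  obtain Z k where k: "k \<le> 3 * Suc n ^ 3" and Z: "maxsat_formula Z"
    and der: "bounded_derivation V k (PHP n) ({#({||}, 1)#} +
      (\<Sum>i\<le>n. \<Sum>j<n. {#({|Neg (pvar i j)|}, 1)#} + {#({|Neg (pvar i j)|}, - 1)#}) + Z)"
    using derives_PHP[OF KV V] by (auto simp: derives_def)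
  have "bounded_formula V (PHP n)"
    using V by (fastforce simp: bounded_formula_def in_PHP_iff pigeon_clause_def hole_clause_def
      fset_of_list.rep_eq literals_below_def)
  from bounded_derivation_proof[OF der this] obtain Fs where Fs: "length Fs = Suc k"
    "is_proof ResSV Fs" "hd Fs = PHP n" "last Fs = {#({||}, 1)#} +
      (\<Sum>i\<le>n. \<Sum>j<n. {#({|Neg (pvar i j)|}, 1)#} + {#({|Neg (pvar i j)|}, - 1)#}) + Z"
    "\<forall>H \<in> set Fs. bounded_formula V H \<and> size H \<le> size (PHP n) + k * V"
    by blast
  let ?F = "{#({||}, 1)#} + Z"
  have "regroup (?F + (\<Sum>p \<in> {..n} \<times> {..<n}. {#({|Neg (pvar (fst p) (snd p))|}, 1)#} +
      {#({|Neg (pvar (fst p) (snd p))|}, - 1)#})) ?F"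
    by (rule regroup_cancel) simp
  moreover have "(\<Sum>p \<in> {..n} \<times> {..<n}. {#({|Neg (pvar (fst p) (snd p))|}, 1 :: ereal)#} +
      {#({|Neg (pvar (fst p) (snd p))|}, - 1)#}) =
      (\<Sum>i\<le>n. \<Sum>j<n. {#({|Neg (pvar i j)|}, 1)#} + {#({|Neg (pvar i j)|}, - 1)#})"
    unfolding sum.cartesian_product by (intro sum.cong) auto
  \<comment> \<open>All negative units are cancelled in the regrouping that is allowed after the
    last formula.\<close>
  ultimately have "regroup (last Fs) ?F" unfolding Fs(4) by (simp only: add_ac)
  moreover have "contained (weighted {||} (MaxSAT (PHP n))) ?F"
    using MaxSAT_PHP_le by (auto simp: contained_def weighted_def)
  moreover have "\<forall>(C, w) \<in># ?F. 0 < w" using Z by (auto simp: maxsat_formula_def)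
  ultimately have ref: "refutation ResSV (PHP n) Fs"
    unfolding refutation_def proof_of_def using Fs(2,3) maxsat_formula_PHP by blast
  define s where "s = K + K ^ 3 + 3 * K ^ 3 * V"
  have "k * V \<le> 3 * K ^ 3 * V" using k by (intro mult_le_mono1) (simp add: K_def)
  then have "size (PHP n) + k * V \<le> s"
    unfolding s_def using size_PHP[of n] unfolding K_def by linarith
  then have "bounded_formula V H \<and> size H \<le> s" if "H \<in> set Fs" for H
    using Fs(5) that order_trans by blast
  from written_proof_exists[OF this, where \<mu> = \<mu>]
  obtain Ws where Ws: "map formula_of Ws = Fs" "\<forall>W \<in> set Ws. \<forall>(C, w) \<in> set W. w \<in> weights \<mu>"
    "length (encode_proof \<mu> Ws) \<le> length Fs * (s * (2 * V * (V + 1) + 6) + 1)"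
    by blast
  note Ws(3)
  also have "length Fs * (s * (2 * V * (V + 1) + 6) + 1) \<le> (3 * K ^ 3 + 1) * (s * (2 * V * (V + 1) + 6) + 1)"
    using Fs(1) k by (intro mult_le_mono1) (simp add: K_def)
  also have "\<dots> = encoding_bound (Suc n)"
    by (simp only: encoding_bound_def Let_def s_def V_def K_def)
  finally show ?thesis using ref Ws(1,2) unfolding written_refutation_def by blast
qed

section \<open>Separation\<close>

lemma poly_encoding_bound: "poly (encoding_bound p) x = encoding_bound (poly p x)"
  by (simp add: encoding_bound_def Let_def)

text \<open>The simulation is the identity, computed by the empty program, which has halted before
  its first step.\<close>

lemma ResSV_p_simulates_ResS: "p_simulates \<mu> ResSV ResS"
proof -
  have "proof_step ResSV F G" if "proof_step ResS F G" for F G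
    using that by (auto simp: proof_step_def ResS_def ResSV_def)
  then have "written_refutation \<mu> ResSV F Fs" if "written_refutation \<mu> ResS F Fs" for F Fs
    using that by (simp add: written_refutation_def refutation_def proof_of_def is_proof_def)
  moreover have "[] \<in> programs \<mu>" by (cases \<mu>) simp_all
  then have "polytime_on \<mu> (encode_proof \<mu>) X (\<lambda>Fs. Fs)" for X
    unfolding polytime_on_def
    by (intro bexI[of _ "[]"] exI[of _ 0]) (simp_all add: outputs_within_def initial_def)
  ultimately show ?thesis unfolding p_simulates_def by blast
qed

lemma ResS_not_p_simulates_ResSV: "\<not> p_simulates \<mu> ResS ResSV"
proof
  assume "p_simulates \<mu> ResS ResSV"
  then obtain f M and q :: "nat poly" where
    out: "\<And>F Ws. written_refutation \<mu> ResSV F Ws \<Longrightarrow>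
      outputs_within M (encode_proof \<mu> Ws) (poly q (length (encode_proof \<mu> Ws))) (encode_proof \<mu> (f Ws))"
    and sim: "\<And>F Ws. written_refutation \<mu> ResSV F Ws \<Longrightarrow> written_refutation \<mu> ResS F (f Ws)"
    unfolding p_simulates_def polytime_on_def by blast
  \<comment> \<open>The polynomial \<open>[:0, 6:]\<close> substitutes \<open>6 * a\<close> for the
    number of pigeons.\<close>
  define b :: "nat poly" where "b = encoding_bound [:0, 6:]"
  obtain a where a: "2 \<le> a" and less: "35 ^ (3 * a) * poly (b + pcompose q b) a < 36 ^ (3 * a)"
    using exponential_exceeds_poly by blast
  have b: "poly b a = encoding_bound (6 * a)" by (simp add: b_def poly_encoding_bound mult.commute)
  obtain n where n: "Suc n = 6 * a" using a by (metis Suc_pred mult_pos_pos pos2 less_le_trans zero_less_numeral)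
  obtain Ws where Ws: "written_refutation \<mu> ResSV (PHP n) Ws" "length (encode_proof \<mu> Ws) \<le> poly b a"
    using ResSV_PHP_upper_bound[of \<mu> n] unfolding n b by blast
  have ref: "refutation ResS (PHP n) (map formula_of (f Ws))"
    using sim[OF Ws(1)] by (simp add: written_refutation_def)
  then have "f Ws \<noteq> []" by (auto simp: refutation_def proof_of_def is_proof_def)
  \<comment> \<open>The simulating machine cannot write more than input length plus running time, so
    the \<open>ResS\<close> refutation would have polynomially many clauses.\<close>
  then have "length (encode_proof \<mu> (f Ws)) \<le>
      length (encode_proof \<mu> Ws) + poly q (length (encode_proof \<mu> Ws))"
    using out[OF Ws(1)] encode_proof_last by (intro outputs_within_length) auto
  also have "\<dots> \<le> poly (b + pcompose q b) a"
    using Ws(2) poly_nat_mono[OF Ws(2), of q] by (simp add: poly_pcompose)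
  finally have "card (\<Union>F \<in> set (map formula_of (f Ws)). clauses F) \<le> poly (b + pcompose q b) a"
    using card_proof_clauses_le_encoding order_trans by blast
  then have "35 ^ (3 * a) * card (\<Union>F \<in> set (map formula_of (f Ws)). clauses F)
      \<le> 35 ^ (3 * a) * poly (b + pcompose q b) a"
    by (rule mult_le_mono2)
  then show False using ResS_PHP_lower_bound[OF ref n a] less by linarith
qed

theorem theorem10: "\<forall>\<mu>. stronger \<mu> ResSV ResS"
  by (simp add: stronger_def ResSV_p_simulates_ResS ResS_not_p_simulates_ResSV)

end
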